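(* Let $F$ be a linearly differentially closed differential field of characteristic zero whose field of constants $C$ is algebraically closed and satisfies $C\neq F$. Let $\theta:F\langle\partial\rangle\to M_C(F)$ be the homomorphism sending a differential operator $P$ to the class modulo $I(F)$ of the $C$-linear map $F\to F$, $a\mapsto P(a)$. Then $\theta$ can be extended to an embedding (injective ring homomorphism) $F(\partial)\to M_C(F)$.
   Context: A differential field is a (commutative) field $F$ with a derivation $a\mapsto a'$; its field of constants is $C=\{a\in F: a'=0\}$. The ring of differential operators $F\langle\partial\rangle$ is the ring generated by $F$ and a symbol $\partial$ subject to $\partial a-a\partial=a'$ for all $a\in F$. Every nonzero $P\in F\langle\partial\rangle$ is uniquely $P=a_0+a_1\partial+\cdots+a_n\partial^n$ with $a_i\in F$, $a_n\ne 0$; $n=\deg(P)$. $P$ acts on $F$ by $P(a)=a_0a+a_1a'+\cdots+a_na^{(n)}$. The ring $F\langle\partial\rangle$ is an Ore domain, and $F(\partial)$ denotes its (noncommutative) field of quotients. $F$ is called linearly differentially closed if every $P\in F\langle\partial\rangle$ with $\deg(P)\ge 1$ has a nonzero solution $a\in F$ of $P(a)=0$; for such fields the following properties are taken as part of the setting: every differential operator is a product of operators of degree at most one, every nonzero differential operator $P:F\to F$ is onto, and $\dim_C\{a\in F:P(a)=0\}=\deg(P)$ for every nonzero $P$. For an infinite-dimensional $C$-vector space $V$, $\mathrm{End}_C(V)$ is the ring of $C$-linear maps $V\to V$, $I(V)$ is the two-sided ideal of maps with finite-dimensional image, and the Calkin algebra of $V$ is $M_C(V)=\mathrm{End}_C(V)/I(V)$.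 *)

theory Defs
  imports "HOL-Algebra.Algebra"
begin

section \<open>Differential fields and differential operators\<close>

locale differential_field = field F for F (structure) +
  fixes \<delta> :: "'a \<Rightarrow> 'a"
  assumes deriv_closed: "a \<in> carrier F \<Longrightarrow> \<delta> a \<in> carrier F"
    and deriv_add: "\<lbrakk> a \<in> carrier F; b \<in> carrier F \<rbrakk> \<Longrightarrow> \<delta> (a \<oplus> b) = \<delta> a \<oplus> \<delta> b"
    and deriv_mult: "\<lbrakk> a \<in> carrier F; b \<in> carrier F \<rbrakk> \<Longrightarrow> \<delta> (a \<otimes> b) = \<delta> a \<otimes> b \<oplus> a \<otimes> \<delta> b"

definition constants :: "('a, 'm) ring_scheme \<Rightarrow> ('a \<Rightarrow> 'a) \<Rightarrow> 'a set"
  where "constants F \<delta> = {a \<in> carrier F. \<delta> a = \<zero>\<^bsub>F\<^esub>}"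

text \<open>
  An operator \<open>P = P 0 + P 1 \<partial> + \<dots> + P n \<partial>\<^sup>n\<close> is represented by its finitely supported
  sequence of coefficients, as in \<^const>\<open>UP\<close>. Additively nothing changes, so the degree of an
  operator is \<^const>\<open>deg\<close>; the zero operator gets degree 0.

  The product is determined by the relation \<open>\<partial> a = a \<partial> + \<delta> a\<close>: it gives
  \<open>\<partial> (\<Sum>n. Q n \<partial>\<^sup>n) = \<Sum>n. (\<delta> (Q n) \<partial>\<^sup>n + Q n \<partial>\<^sup>n\<^sup>+\<^sup>1)\<close>, which is \<open>D_times\<close> below, and
  then \<open>P Q = \<Sum>i. P i (\<partial>\<^sup>i Q)\<close>.
\<close>

definition D_times :: "('a, 'm) ring_scheme \<Rightarrow> ('a \<Rightarrow> 'a) \<Rightarrow> (nat \<Rightarrow> 'a) \<Rightarrow> (nat \<Rightarrow> 'a)"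
  where "D_times F \<delta> Q = (\<lambda>n. \<delta> (Q n) \<oplus>\<^bsub>F\<^esub> (if n = 0 then \<zero>\<^bsub>F\<^esub> else Q (n - 1)))"

definition diff_ops :: "('a, 'm) ring_scheme \<Rightarrow> ('a \<Rightarrow> 'a) \<Rightarrow> ('a, nat \<Rightarrow> 'a) up_ring"
  where "diff_ops F \<delta> = (UP F)\<lparr> monoid.mult :=
    (\<lambda>P \<in> up F. \<lambda>Q \<in> up F. \<lambda>n. \<Oplus>\<^bsub>F\<^esub>i \<in> {..deg F P}. P i \<otimes>\<^bsub>F\<^esub> ((D_times F \<delta> ^^ i) Q) n) \<rparr>"

definition apply_op :: "('a, 'm) ring_scheme \<Rightarrow> ('a \<Rightarrow> 'a) \<Rightarrow> (nat \<Rightarrow> 'a) \<Rightarrow> 'a \<Rightarrow> 'a"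
  where "apply_op F \<delta> P a = (\<Oplus>\<^bsub>F\<^esub>i \<in> {..deg F P}. P i \<otimes>\<^bsub>F\<^esub> (\<delta> ^^ i) a)"

definition linearly_differentially_closed :: "('a, 'm) ring_scheme \<Rightarrow> ('a \<Rightarrow> 'a) \<Rightarrow> bool"
  where "linearly_differentially_closed F \<delta> \<longleftrightarrow>
    (\<forall>P \<in> carrier (diff_ops F \<delta>). deg F P \<ge> 1 \<longrightarrow>
      (\<exists>a \<in> carrier F. a \<noteq> \<zero>\<^bsub>F\<^esub> \<and> apply_op F \<delta> P a = \<zero>\<^bsub>F\<^esub>))"


section \<open>The skew field of fractions of an Ore domain\<close>

text \<open>
  The pair \<open>(P, Q)\<close> stands for the left fraction \<open>Q\<^sup>-\<^sup>1 P\<close>. Two fractions are equal iff they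
  agree after being brought to some common denominator. The definitions make sense for any
  ring \<open>R\<close>, but they yield a skew field only for left Ore domains.
\<close>

definition fractions :: "('a, 'm) ring_scheme \<Rightarrow> ('a \<times> 'a) set"
  where "fractions R = carrier R \<times> (carrier R - {\<zero>\<^bsub>R\<^esub>})"

definition frac_rel :: "('a, 'm) ring_scheme \<Rightarrow> (('a \<times> 'a) \<times> ('a \<times> 'a)) set"
  where "frac_rel R = {((P1, Q1), (P2, Q2)).
    (P1, Q1) \<in> fractions R \<and> (P2, Q2) \<in> fractions R \<and>
    (\<exists>U \<in> carrier R. \<exists>V \<in> carrier R. U \<otimes>\<^bsub>R\<^esub> Q1 = V \<otimes>\<^bsub>R\<^esub> Q2 \<and> U \<otimes>\<^bsub>R\<^esub> Q1 \<noteq> \<zero>\<^bsub>R\<^esub> \<and>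
      U \<otimes>\<^bsub>R\<^esub> P1 = V \<otimes>\<^bsub>R\<^esub> P2)}"

definition fraction :: "('a, 'm) ring_scheme \<Rightarrow> 'a \<Rightarrow> 'a \<Rightarrow> ('a \<times> 'a) set"
  where "fraction R P Q = frac_rel R `` {(P, Q)}"

text \<open>
  Sums: if \<open>U Q1 = V Q2 \<noteq> 0\<close> then \<open>Q1\<^sup>-\<^sup>1 P1 + Q2\<^sup>-\<^sup>1 P2 = (U Q1)\<^sup>-\<^sup>1 (U P1 + V P2)\<close>.
  Products: if \<open>V P1 = U Q2\<close> with \<open>V \<noteq> 0\<close> then \<open>P1 Q2\<^sup>-\<^sup>1 = V\<^sup>-\<^sup>1 U\<close>, hence
  \<open>(Q1\<^sup>-\<^sup>1 P1) (Q2\<^sup>-\<^sup>1 P2) = (V Q1)\<^sup>-\<^sup>1 (U P2)\<close>. The unions below range over all choices of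
  representatives and multipliers; in an Ore domain all of them give the same class.
\<close>

definition skew_fraction_field :: "('a, 'm) ring_scheme \<Rightarrow> (('a \<times> 'a) set) ring"
  where "skew_fraction_field R =
    \<lparr> carrier = fractions R // frac_rel R,
      monoid.mult = (\<lambda>A B. \<Union> {fraction R (U \<otimes>\<^bsub>R\<^esub> P2) (V \<otimes>\<^bsub>R\<^esub> Q1) | U V P1 Q1 P2 Q2.
        (P1, Q1) \<in> A \<and> (P2, Q2) \<in> B \<and> U \<in> carrier R \<and> V \<in> carrier R \<and>
        V \<noteq> \<zero>\<^bsub>R\<^esub> \<and> V \<otimes>\<^bsub>R\<^esub> P1 = U \<otimes>\<^bsub>R\<^esub> Q2}),
      one = fraction R \<one>\<^bsub>R\<^esub> \<one>\<^bsub>R\<^esub>,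
      ring.zero = fraction R \<zero>\<^bsub>R\<^esub> \<one>\<^bsub>R\<^esub>,
      ring.add = (\<lambda>A B. \<Union> {fraction R (U \<otimes>\<^bsub>R\<^esub> P1 \<oplus>\<^bsub>R\<^esub> V \<otimes>\<^bsub>R\<^esub> P2) (U \<otimes>\<^bsub>R\<^esub> Q1) | U V P1 Q1 P2 Q2.
        (P1, Q1) \<in> A \<and> (P2, Q2) \<in> B \<and> U \<in> carrier R \<and> V \<in> carrier R \<and>
        U \<otimes>\<^bsub>R\<^esub> Q1 = V \<otimes>\<^bsub>R\<^esub> Q2 \<and> U \<otimes>\<^bsub>R\<^esub> Q1 \<noteq> \<zero>\<^bsub>R\<^esub>}) \<rparr>"

definition frac_embed :: "('a, 'm) ring_scheme \<Rightarrow> 'a \<Rightarrow> ('a \<times> 'a) set"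
  where "frac_embed R P = fraction R P \<one>\<^bsub>R\<^esub>"


section \<open>The Calkin algebra\<close>

text \<open>
  Here \<open>V\<close> is a vector space over a subfield \<open>K\<close> of \<open>R\<close>, given as a \<open>K\<close>-subspace of \<open>R\<close>
  (such as \<open>V = carrier R\<close>). Maps are extensional, so that equality in the carrier is equality
  of maps on \<open>V\<close>.
\<close>

definition lin_end :: "('a, 'm) ring_scheme \<Rightarrow> 'a set \<Rightarrow> 'a set \<Rightarrow> ('a \<Rightarrow> 'a) ring"
  where "lin_end R K V =
    \<lparr> carrier = {f \<in> V \<rightarrow>\<^sub>E V. (\<forall>x \<in> V. \<forall>y \<in> V. f (x \<oplus>\<^bsub>R\<^esub> y) = f x \<oplus>\<^bsub>R\<^esub> f y) \<and>
        (\<forall>k \<in> K. \<forall>x \<in> V. f (k \<otimes>\<^bsub>R\<^esub> x) = k \<otimes>\<^bsub>R\<^esub> f x)},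
      monoid.mult = (\<lambda>f g. compose V f g),
      one = (\<lambda>x \<in> V. x),
      ring.zero = (\<lambda>x \<in> V. \<zero>\<^bsub>R\<^esub>),
      ring.add = (\<lambda>f g. \<lambda>x \<in> V. f x \<oplus>\<^bsub>R\<^esub> g x) \<rparr>"

definition finite_rank :: "('a, 'm) ring_scheme \<Rightarrow> 'a set \<Rightarrow> 'a set \<Rightarrow> ('a \<Rightarrow> 'a) set"
  where "finite_rank R K V = {f \<in> carrier (lin_end R K V). ring.finite_dimension R K (f ` V)}"

definition calkin_algebra :: "('a, 'm) ring_scheme \<Rightarrow> 'a set \<Rightarrow> 'a set \<Rightarrow> ('a \<Rightarrow> 'a) set ring"
  where "calkin_algebra R K V = lin_end R K V Quot finite_rank R K V"

definition calkin_class ::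
    "('a, 'm) ring_scheme \<Rightarrow> ('a \<Rightarrow> 'a) \<Rightarrow> (nat \<Rightarrow> 'a) \<Rightarrow> ('a \<Rightarrow> 'a) set"
  where "calkin_class F \<delta> P =
    finite_rank F (constants F \<delta>) (carrier F)
      +>\<^bsub>lin_end F (constants F \<delta>) (carrier F)\<^esub> (\<lambda>a \<in> carrier F. apply_op F \<delta> P a)"

end

theory Submission
  imports Defs
begin

text \<open>
  Two facts about an operator \<open>P \<noteq> 0\<close> carry the proof: it maps \<open>F\<close> onto \<open>F\<close>, and its kernel is
  finite-dimensional over the constants. Choosing a linear complement of the kernel gives a linear
  right inverse \<open>S\<close> of \<open>P\<close>, and \<open>S P - 1\<close> takes values in the kernel. So \<open>S\<close> is a two-sided inverse
  of \<open>P\<close> modulo maps of finite rank: \<open>\<theta>\<close> sends nonzero operators to units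
  (\<open>calkin_unit\<close>). Since the kernels of the powers of \<open>\<partial>\<close> have unbounded dimension, \<open>F\<close> is
  infinite-dimensional and the Calkin algebra is not the zero ring.

  The rest is the universal property of the Ore localisation. A homomorphism \<open>h\<close> from a left Ore
  ring to a nonzero ring that sends nonzero elements to units extends by
  \<open>Q\<^sup>-\<^sup>1 P \<mapsto> h(Q)\<^sup>-\<^sup>1 h(P)\<close>. The equivalence of fractions turns out to be equality of these
  values, so the extension is injective, and the sum and the product of fractions, which are
  defined as unions over all representatives, are determined by their values. In particular
  the ring axioms for fractions need no computation with common denominators: they are inherited
  from the target (\<open>ring_if_embeds\<close>, \<open>skew_fraction_field_embeds\<close>).

  The same transport handles the operators themselves. Surjectivity implies that only the zero
  operator acts as zero, so the operators embed into the linear endomorphisms of \<open>F\<close>; hence they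
  form a ring in which products of nonzero elements are nonzero. The left Ore condition comes from
  Euclid's algorithm based on right division (\<open>right_division\<close>, \<open>ops_left_ore\<close>).
\<close>

section \<open>Transport of the ring axioms along an embedding\<close>

text \<open>
  Every ring axiom except the existence of negatives is an identity, and an identity can be
  checked after applying an injective map that respects the operations.
\<close>

lemma ring_if_embeds:
  fixes R (structure) and S (structure)
  assumes S: "ring S"
    and inj: "inj_on h (carrier R)"
    and h: "h \<in> ring_hom R S"
    and h_zero: "h \<zero> = \<zero>\<^bsub>S\<^esub>"
    and closed: "\<zero> \<in> carrier R" "\<one> \<in> carrier R"
      "\<And>x y. \<lbrakk> x \<in> carrier R; y \<in> carrier R \<rbrakk> \<Longrightarrow> x \<oplus> y \<in> carrier R"
      "\<And>x y. \<lbrakk> x \<in> carrier R; y \<in> carrier R \<rbrakk> \<Longrightarrow> x \<otimes> y \<in> carrier R"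
    and neg: "\<And>x. x \<in> carrier R \<Longrightarrow> \<exists>y \<in> carrier R. h y = \<ominus>\<^bsub>S\<^esub> h x"
  shows "ring R"
proof -
  interpret S: ring S by (rule S)
  note hs = ring_hom_memE[OF h]
  note eqI = inj_onD[OF inj]
  show ?thesis
  proof (intro ringI abelian_groupI monoidI)
    fix x assume x: "x \<in> carrier R"
    obtain y where "y \<in> carrier R" "h y = \<ominus>\<^bsub>S\<^esub> h x" using neg[OF x] by blast
    then show "\<exists>y \<in> carrier R. y \<oplus> x = \<zero>"
      using x by (intro bexI[of _ y] eqI) (simp_all add: closed hs h_zero S.l_neg)
  qed (auto intro!: eqI simp: closed hs h_zero S.a_ac S.m_assoc S.l_distr S.r_distr)
qed


section \<open>Fractions over a left Ore ring\<close>

text \<open>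
  Units of a nonzero ring are nonzero, so \<open>hom_unit\<close> makes \<open>h\<close> injective and excludes zero
  divisors in \<open>R\<close>.
\<close>

locale ore_ring_hom = ring_hom_ring R M h for R (structure) and M (structure) and h +
  assumes hom_unit: "\<lbrakk> q \<in> carrier R; q \<noteq> \<zero>\<^bsub>R\<^esub> \<rbrakk> \<Longrightarrow> h q \<in> Units M"
    and nontrivial: "\<one>\<^bsub>M\<^esub> \<noteq> \<zero>\<^bsub>M\<^esub>"
    and left_ore: "\<lbrakk> p \<in> carrier R; q \<in> carrier R; q \<noteq> \<zero>\<^bsub>R\<^esub> \<rbrakk> \<Longrightarrow>
      \<exists>u \<in> carrier R. \<exists>v \<in> carrier R. v \<noteq> \<zero>\<^bsub>R\<^esub> \<and> v \<otimes>\<^bsub>R\<^esub> p = u \<otimes>\<^bsub>R\<^esub> q"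
begin

text \<open>
  The pair \<open>(p, q)\<close> stands for the left fraction \<open>q\<^sup>-\<^sup>1 p\<close>.
\<close>

definition val :: "'a \<times> 'a \<Rightarrow> 'c"
  where "val x = inv\<^bsub>M\<^esub> (h (snd x)) \<otimes>\<^bsub>M\<^esub> h (fst x)"

lemma unit_nonzero: "x \<in> Units M \<Longrightarrow> x \<noteq> \<zero>\<^bsub>M\<^esub>"
  using S.Units_l_inv S.Units_inv_closed S.r_null nontrivial by metis

lemma hom_eq_zero_iff: "p \<in> carrier R \<Longrightarrow> h p = \<zero>\<^bsub>M\<^esub> \<longleftrightarrow> p = \<zero>\<^bsub>R\<^esub>"
  using hom_unit unit_nonzero by auto

lemma hom_eqD: "\<lbrakk> p \<in> carrier R; q \<in> carrier R; h p = h q \<rbrakk> \<Longrightarrow> p = q"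
  using hom_eq_zero_iff[of "p \<ominus>\<^bsub>R\<^esub> q"]
  by (simp add: R.minus_eq S.r_neg R.r_right_minus_eq[unfolded R.minus_eq])

lemma mult_nonzero:
  assumes "p \<in> carrier R" "q \<in> carrier R" "p \<noteq> \<zero>\<^bsub>R\<^esub>" "q \<noteq> \<zero>\<^bsub>R\<^esub>"
  shows "p \<otimes>\<^bsub>R\<^esub> q \<noteq> \<zero>\<^bsub>R\<^esub>"
proof -
  have "h (p \<otimes>\<^bsub>R\<^esub> q) \<in> Units M"
    using assms by (simp add: hom_unit S.Units_m_closed)
  then show ?thesis using unit_nonzero[of "h (p \<otimes>\<^bsub>R\<^esub> q)"] by (metis hom_zero)
qed

lemma val_closed: "x \<in> fractions R \<Longrightarrow> val x \<in> carrier M"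
  by (auto simp: val_def fractions_def hom_unit)

lemma val_eq_iff:
  assumes "(p, q) \<in> fractions R" "m \<in> carrier M"
  shows "val (p, q) = m \<longleftrightarrow> h p = h q \<otimes>\<^bsub>M\<^esub> m"
proof -
  have p: "p \<in> carrier R" and q: "q \<in> carrier R" "h q \<in> Units M"
    using assms(1) by (auto simp: fractions_def hom_unit)
  show ?thesis
  proof
    assume "val (p, q) = m"
    then have "h q \<otimes>\<^bsub>M\<^esub> m = (h q \<otimes>\<^bsub>M\<^esub> inv\<^bsub>M\<^esub> (h q)) \<otimes>\<^bsub>M\<^esub> h p"
      using p q by (auto simp: val_def S.m_assoc simp del: S.Units_r_inv)
    then show "h p = h q \<otimes>\<^bsub>M\<^esub> m" using p q by simp
  next
    assume "h p = h q \<otimes>\<^bsub>M\<^esub> m"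
    then have "val (p, q) = (inv\<^bsub>M\<^esub> (h q) \<otimes>\<^bsub>M\<^esub> h q) \<otimes>\<^bsub>M\<^esub> m"
      using q assms(2) by (simp add: val_def S.m_assoc del: S.Units_l_inv)
    then show "val (p, q) = m" using q assms(2) by simp
  qed
qed

lemma hom_numerator:
  assumes "(p, q) \<in> fractions R"
  shows "h p = h q \<otimes>\<^bsub>M\<^esub> val (p, q)"
  using val_eq_iff[OF assms] val_closed[OF assms] by blast

text \<open>
  Multiplying numerator and denominator by a common left factor does not change the value, so
  equivalent fractions have equal values. Conversely the Ore condition supplies a common multiple
  of the two denominators; equal values then force equal numerators, because \<open>h\<close> is injective. This
  also shows that \<open>frac_rel R\<close> is an equivalence relation.
\<close>

lemma frac_rel_iff:
  "(x, y) \<in> frac_rel R \<longleftrightarrow> x \<in> fractions R \<and> y \<in> fractions R \<and> val x = val y"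
proof (cases "x \<in> fractions R \<and> y \<in> fractions R")
  case False
  then show ?thesis by (auto simp: frac_rel_def)
next
  case True
  obtain p1 q1 p2 q2 where xy: "x = (p1, q1)" "y = (p2, q2)" by fastforce
  have f: "(p1, q1) \<in> fractions R" "(p2, q2) \<in> fractions R" using True xy by auto
  then have c: "p1 \<in> carrier R" "q1 \<in> carrier R" "p2 \<in> carrier R" "q2 \<in> carrier R"
    and nz: "q1 \<noteq> \<zero>\<^bsub>R\<^esub>" "q2 \<noteq> \<zero>\<^bsub>R\<^esub>" by (auto simp: fractions_def)
  note v = val_closed[OF f(1)] val_closed[OF f(2)]
  have expand: "h (u \<otimes>\<^bsub>R\<^esub> p) = h (u \<otimes>\<^bsub>R\<^esub> q) \<otimes>\<^bsub>M\<^esub> val (p, q)"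
    if "(p, q) \<in> fractions R" "u \<in> carrier R" for p q u
    using hom_numerator[OF that(1)] val_closed[OF that(1)] that
    by (simp add: fractions_def S.m_assoc)
  have "(x, y) \<in> frac_rel R \<longleftrightarrow> (\<exists>u \<in> carrier R. \<exists>v \<in> carrier R. u \<otimes>\<^bsub>R\<^esub> q1 = v \<otimes>\<^bsub>R\<^esub> q2 \<and>
      u \<otimes>\<^bsub>R\<^esub> q1 \<noteq> \<zero>\<^bsub>R\<^esub> \<and> u \<otimes>\<^bsub>R\<^esub> p1 = v \<otimes>\<^bsub>R\<^esub> p2)" (is "_ \<longleftrightarrow> ?E")
    unfolding xy frac_rel_def using f by simp
  also have "?E \<longleftrightarrow> val x = val y"
  proof
    assume ?E
    then obtain u v where uv: "u \<in> carrier R" "v \<in> carrier R" "u \<otimes>\<^bsub>R\<^esub> q1 = v \<otimes>\<^bsub>R\<^esub> q2"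
      "u \<otimes>\<^bsub>R\<^esub> q1 \<noteq> \<zero>\<^bsub>R\<^esub>" "u \<otimes>\<^bsub>R\<^esub> p1 = v \<otimes>\<^bsub>R\<^esub> p2" by blast
    let ?d = "h (u \<otimes>\<^bsub>R\<^esub> q1)"
    have d: "?d \<in> Units M" using uv c by (intro hom_unit) auto
    have "?d \<otimes>\<^bsub>M\<^esub> val x = ?d \<otimes>\<^bsub>M\<^esub> val y"
      using expand[OF f(1) uv(1)] expand[OF f(2) uv(2)] uv(3,5) xy by simp
    then show "val x = val y" using d v xy S.Units_l_cancel by simp
  next
    assume eq: "val x = val y"
    obtain u v where uv: "u \<in> carrier R" "v \<in> carrier R" "v \<noteq> \<zero>\<^bsub>R\<^esub>" "v \<otimes>\<^bsub>R\<^esub> q1 = u \<otimes>\<^bsub>R\<^esub> q2"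
      using left_ore[OF c(2,4) nz(2)] by blast
    have "h (v \<otimes>\<^bsub>R\<^esub> p1) = h (u \<otimes>\<^bsub>R\<^esub> p2)"
      using expand[OF f(1) uv(2)] expand[OF f(2) uv(1)] uv(4) eq xy by simp
    then have "v \<otimes>\<^bsub>R\<^esub> p1 = u \<otimes>\<^bsub>R\<^esub> p2" using uv c by (intro hom_eqD) auto
    then show ?E using uv mult_nonzero[OF uv(2) c(2) uv(3) nz(1)] by blast
  qed
  finally show ?thesis using True by simp
qed

lemma fraction_eq:
  "(p, q) \<in> fractions R \<Longrightarrow> fraction R p q = {y \<in> fractions R. val y = val (p, q)}"
  by (auto simp: fraction_def frac_rel_iff)

lemma fraction_closed:
  "(p, q) \<in> fractions R \<Longrightarrow> fraction R p q \<in> carrier (skew_fraction_field R)"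
  by (auto simp: skew_fraction_field_def quotient_def fraction_def)

lemma carrier_skew_fraction_fieldE:
  assumes "A \<in> carrier (skew_fraction_field R)"
  obtains p q where "(p, q) \<in> fractions R" "A = fraction R p q"
  using assms by (auto simp: skew_fraction_field_def quotient_def fraction_def)

text \<open>
  The choice of the representative does not matter, by \<open>frac_rel_iff\<close>.
\<close>

definition class_val :: "('a \<times> 'a) set \<Rightarrow> 'c"
  where "class_val A = val (SOME x. x \<in> A)"

lemma class_val_fraction:
  assumes "(p, q) \<in> fractions R"
  shows "class_val (fraction R p q) = val (p, q)"
proof -
  have "(SOME x. x \<in> fraction R p q) \<in> fraction R p q"
    by (rule someI[of _ "(p, q)"]) (simp add: fraction_eq assms)
  then show ?thesis by (simp add: class_val_def fraction_eq assms)
qed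

lemma mem_class_iff:
  assumes "A \<in> carrier (skew_fraction_field R)"
  shows "x \<in> A \<longleftrightarrow> x \<in> fractions R \<and> val x = class_val A"
proof -
  obtain p q where pq: "(p, q) \<in> fractions R" "A = fraction R p q"
    using assms by (rule carrier_skew_fraction_fieldE)
  have "class_val A = val (p, q)" using pq by (simp add: class_val_fraction)
  then show ?thesis using pq by (simp add: fraction_eq)
qed

lemma classE:
  assumes "A \<in> carrier (skew_fraction_field R)"
  obtains p q where "(p, q) \<in> A"
proof -
  obtain p q where pq: "(p, q) \<in> fractions R" "A = fraction R p q"
    using assms by (rule carrier_skew_fraction_fieldE)
  show thesis by (rule that[of p q]) (simp add: pq fraction_eq)
qed

lemma class_val_closed: "A \<in> carrier (skew_fraction_field R) \<Longrightarrow> class_val A \<in> carrier M"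
  by (metis carrier_skew_fraction_fieldE class_val_fraction val_closed)

lemma class_val_inj: "inj_on class_val (carrier (skew_fraction_field R))"
  proof (rule inj_onI)
  fix A B
  assume A: "A \<in> carrier (skew_fraction_field R)" and B: "B \<in> carrier (skew_fraction_field R)"
    and eq: "class_val A = class_val B"
  show "A = B" by (rule Set.set_eqI) (simp only: mem_class_iff[OF A] mem_class_iff[OF B] eq)
qed

text \<open>
  All fractions of the same value generate the same class, so a union of such classes is a single
  class. This is the well-definedness of the sum and the product.
\<close>

lemma Union_fractions:
  assumes "Zs \<noteq> {}" "\<And>Z. Z \<in> Zs \<Longrightarrow> \<exists>p q. (p, q) \<in> fractions R \<and> Z = fraction R p q \<and> val (p, q) = m"
  shows "(\<Union> Zs) \<in> carrier (skew_fraction_field R) \<and> class_val (\<Union> Zs) = m"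
proof -
  obtain Z where Z: "Z \<in> Zs" using assms(1) by blast
  then obtain p q where pq: "(p, q) \<in> fractions R" "Z = fraction R p q" "val (p, q) = m"
    using assms(2) by blast
  have "Z' = Z" if "Z' \<in> Zs" for Z'
    using assms(2)[OF that] pq by (auto simp: fraction_eq)
  then have "\<Union> Zs = Z" using Z by blast
  then show ?thesis using pq by (simp add: fraction_closed class_val_fraction)
qed

text \<open>
  If \<open>V P1 = U Q2\<close> then \<open>h(U P2) = h(U Q2) b = h(V P1) b = h(V Q1) a b\<close> for the values \<open>a\<close> and
  \<open>b\<close> of the factors. The Ore condition guarantees that the union is not empty.
\<close>

lemma mult_class:
  assumes A: "A \<in> carrier (skew_fraction_field R)" and B: "B \<in> carrier (skew_fraction_field R)"
  shows "A \<otimes>\<^bsub>skew_fraction_field R\<^esub> B \<in> carrier (skew_fraction_field R) \<and>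
    class_val (A \<otimes>\<^bsub>skew_fraction_field R\<^esub> B) = class_val A \<otimes>\<^bsub>M\<^esub> class_val B"
proof -
  define Zs where "Zs = {fraction R (U \<otimes>\<^bsub>R\<^esub> P2) (V \<otimes>\<^bsub>R\<^esub> Q1) | U V P1 Q1 P2 Q2.
        (P1, Q1) \<in> A \<and> (P2, Q2) \<in> B \<and> U \<in> carrier R \<and> V \<in> carrier R \<and>
        V \<noteq> \<zero>\<^bsub>R\<^esub> \<and> V \<otimes>\<^bsub>R\<^esub> P1 = U \<otimes>\<^bsub>R\<^esub> Q2}"
  have AB: "A \<otimes>\<^bsub>skew_fraction_field R\<^esub> B = \<Union> Zs"
    by (simp only: skew_fraction_field_def monoid.simps ring.simps Zs_def)
  note a = class_val_closed[OF A] and b = class_val_closed[OF B]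
  obtain p1 q1 where pq1: "(p1, q1) \<in> A" using A by (rule classE)
  obtain p2 q2 where pq2: "(p2, q2) \<in> B" using B by (rule classE)
  have "p1 \<in> carrier R" "q2 \<in> carrier R" "q2 \<noteq> \<zero>\<^bsub>R\<^esub>"
    using pq1 pq2 by (auto simp: mem_class_iff[OF A] mem_class_iff[OF B] fractions_def)
  then obtain u v where "u \<in> carrier R" "v \<in> carrier R" "v \<noteq> \<zero>\<^bsub>R\<^esub>" "v \<otimes>\<^bsub>R\<^esub> p1 = u \<otimes>\<^bsub>R\<^esub> q2"
    using left_ore[of p1 q2] by blast
  then have "fraction R (u \<otimes>\<^bsub>R\<^esub> p2) (v \<otimes>\<^bsub>R\<^esub> q1) \<in> Zs"
    unfolding Zs_def using pq1 pq2 by blast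
  then have ne: "Zs \<noteq> {}" by blast
  have "\<exists>p q. (p, q) \<in> fractions R \<and> Z = fraction R p q \<and> val (p, q) = class_val A \<otimes>\<^bsub>M\<^esub> class_val B"
    if "Z \<in> Zs" for Z
  proof -
    from that obtain U V P1 Q1 P2 Q2 where Z: "Z = fraction R (U \<otimes>\<^bsub>R\<^esub> P2) (V \<otimes>\<^bsub>R\<^esub> Q1)"
      and m: "(P1, Q1) \<in> A" "(P2, Q2) \<in> B" and UV: "U \<in> carrier R" "V \<in> carrier R"
        "V \<noteq> \<zero>\<^bsub>R\<^esub>" "V \<otimes>\<^bsub>R\<^esub> P1 = U \<otimes>\<^bsub>R\<^esub> Q2"
      unfolding Zs_def by blast
    have f: "(P1, Q1) \<in> fractions R" "(P2, Q2) \<in> fractions R"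
      and v: "val (P1, Q1) = class_val A" "val (P2, Q2) = class_val B"
      using m by (auto simp: mem_class_iff[OF A] mem_class_iff[OF B])
    have c: "P1 \<in> carrier R" "Q1 \<in> carrier R" "P2 \<in> carrier R" "Q2 \<in> carrier R" "Q1 \<noteq> \<zero>\<^bsub>R\<^esub>"
      using f by (auto simp: fractions_def)
    have fr: "(U \<otimes>\<^bsub>R\<^esub> P2, V \<otimes>\<^bsub>R\<^esub> Q1) \<in> fractions R"
      using c UV by (simp add: fractions_def mult_nonzero)
    have n: "h P1 = h Q1 \<otimes>\<^bsub>M\<^esub> class_val A" "h P2 = h Q2 \<otimes>\<^bsub>M\<^esub> class_val B"
      using hom_numerator[OF f(1)] hom_numerator[OF f(2)] v by simp_all
    have "h V \<otimes>\<^bsub>M\<^esub> h P1 = h U \<otimes>\<^bsub>M\<^esub> h Q2"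
      using arg_cong[OF UV(4), of h] UV(1,2) c by simp
    then have "h (U \<otimes>\<^bsub>R\<^esub> P2) = h V \<otimes>\<^bsub>M\<^esub> h P1 \<otimes>\<^bsub>M\<^esub> class_val B"
      using UV c a b by (simp add: n(2) S.m_assoc[symmetric])
    also have "\<dots> = h (V \<otimes>\<^bsub>R\<^esub> Q1) \<otimes>\<^bsub>M\<^esub> (class_val A \<otimes>\<^bsub>M\<^esub> class_val B)"
      using UV c a b by (simp add: n(1) S.m_assoc)
    finally have "val (U \<otimes>\<^bsub>R\<^esub> P2, V \<otimes>\<^bsub>R\<^esub> Q1) = class_val A \<otimes>\<^bsub>M\<^esub> class_val B"
      using val_eq_iff[OF fr] a b by simp
    with fr Z show ?thesis by blast
  qed
  from Union_fractions[OF ne this] show ?thesis unfolding AB by blast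
qed

text \<open>
  Over a common denominator \<open>U Q1 = V Q2\<close> the numerators are \<open>U P1 = (U Q1) a\<close> and
  \<open>V P2 = (U Q1) b\<close> after applying \<open>h\<close>; the Ore condition provides the common denominator.
\<close>

lemma add_class:
  assumes A: "A \<in> carrier (skew_fraction_field R)" and B: "B \<in> carrier (skew_fraction_field R)"
  shows "A \<oplus>\<^bsub>skew_fraction_field R\<^esub> B \<in> carrier (skew_fraction_field R) \<and>
    class_val (A \<oplus>\<^bsub>skew_fraction_field R\<^esub> B) = class_val A \<oplus>\<^bsub>M\<^esub> class_val B"
proof -
  define Zs where "Zs = {fraction R (U \<otimes>\<^bsub>R\<^esub> P1 \<oplus>\<^bsub>R\<^esub> V \<otimes>\<^bsub>R\<^esub> P2) (U \<otimes>\<^bsub>R\<^esub> Q1) | U V P1 Q1 P2 Q2.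
        (P1, Q1) \<in> A \<and> (P2, Q2) \<in> B \<and> U \<in> carrier R \<and> V \<in> carrier R \<and>
        U \<otimes>\<^bsub>R\<^esub> Q1 = V \<otimes>\<^bsub>R\<^esub> Q2 \<and> U \<otimes>\<^bsub>R\<^esub> Q1 \<noteq> \<zero>\<^bsub>R\<^esub>}"
  have AB: "A \<oplus>\<^bsub>skew_fraction_field R\<^esub> B = \<Union> Zs"
    by (simp only: skew_fraction_field_def monoid.simps ring.simps Zs_def)
  note a = class_val_closed[OF A] and b = class_val_closed[OF B]
  obtain p1 q1 where pq1: "(p1, q1) \<in> A" using A by (rule classE)
  obtain p2 q2 where pq2: "(p2, q2) \<in> B" using B by (rule classE)
  have q: "q1 \<in> carrier R" "q1 \<noteq> \<zero>\<^bsub>R\<^esub>" "q2 \<in> carrier R" "q2 \<noteq> \<zero>\<^bsub>R\<^esub>"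
    using pq1 pq2 by (auto simp: mem_class_iff[OF A] mem_class_iff[OF B] fractions_def)
  then obtain u v where uv: "u \<in> carrier R" "v \<in> carrier R" "v \<noteq> \<zero>\<^bsub>R\<^esub>" "v \<otimes>\<^bsub>R\<^esub> q1 = u \<otimes>\<^bsub>R\<^esub> q2"
    using left_ore[of q1 q2] by blast
  moreover have "v \<otimes>\<^bsub>R\<^esub> q1 \<noteq> \<zero>\<^bsub>R\<^esub>" using uv q by (intro mult_nonzero)
  ultimately have "fraction R (v \<otimes>\<^bsub>R\<^esub> p1 \<oplus>\<^bsub>R\<^esub> u \<otimes>\<^bsub>R\<^esub> p2) (v \<otimes>\<^bsub>R\<^esub> q1) \<in> Zs"
    unfolding Zs_def using pq1 pq2 by blast
  then have ne: "Zs \<noteq> {}" by blast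
  have "\<exists>p q. (p, q) \<in> fractions R \<and> Z = fraction R p q \<and> val (p, q) = class_val A \<oplus>\<^bsub>M\<^esub> class_val B"
    if "Z \<in> Zs" for Z
  proof -
    from that obtain U V P1 Q1 P2 Q2
      where Z: "Z = fraction R (U \<otimes>\<^bsub>R\<^esub> P1 \<oplus>\<^bsub>R\<^esub> V \<otimes>\<^bsub>R\<^esub> P2) (U \<otimes>\<^bsub>R\<^esub> Q1)"
      and m: "(P1, Q1) \<in> A" "(P2, Q2) \<in> B" and UV: "U \<in> carrier R" "V \<in> carrier R"
        "U \<otimes>\<^bsub>R\<^esub> Q1 = V \<otimes>\<^bsub>R\<^esub> Q2" "U \<otimes>\<^bsub>R\<^esub> Q1 \<noteq> \<zero>\<^bsub>R\<^esub>"
      unfolding Zs_def by blast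
    have f: "(P1, Q1) \<in> fractions R" "(P2, Q2) \<in> fractions R"
      and v: "val (P1, Q1) = class_val A" "val (P2, Q2) = class_val B"
      using m by (auto simp: mem_class_iff[OF A] mem_class_iff[OF B])
    have c: "P1 \<in> carrier R" "Q1 \<in> carrier R" "P2 \<in> carrier R" "Q2 \<in> carrier R"
      using f by (auto simp: fractions_def)
    have fr: "(U \<otimes>\<^bsub>R\<^esub> P1 \<oplus>\<^bsub>R\<^esub> V \<otimes>\<^bsub>R\<^esub> P2, U \<otimes>\<^bsub>R\<^esub> Q1) \<in> fractions R"
      using c UV by (simp add: fractions_def)
    have n: "h P1 = h Q1 \<otimes>\<^bsub>M\<^esub> class_val A" "h P2 = h Q2 \<otimes>\<^bsub>M\<^esub> class_val B"
      using hom_numerator[OF f(1)] hom_numerator[OF f(2)] v by simp_all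
    have e: "h U \<otimes>\<^bsub>M\<^esub> h Q1 = h V \<otimes>\<^bsub>M\<^esub> h Q2"
      using arg_cong[OF UV(3), of h] UV(1,2) c by simp
    have "h (U \<otimes>\<^bsub>R\<^esub> P1 \<oplus>\<^bsub>R\<^esub> V \<otimes>\<^bsub>R\<^esub> P2) =
        h U \<otimes>\<^bsub>M\<^esub> h Q1 \<otimes>\<^bsub>M\<^esub> class_val A \<oplus>\<^bsub>M\<^esub> h V \<otimes>\<^bsub>M\<^esub> h Q2 \<otimes>\<^bsub>M\<^esub> class_val B"
      using UV(1,2) c a b by (simp add: n S.m_assoc)
    also have "\<dots> = h (U \<otimes>\<^bsub>R\<^esub> Q1) \<otimes>\<^bsub>M\<^esub> (class_val A \<oplus>\<^bsub>M\<^esub> class_val B)"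
      using UV(1,2) c a b by (simp add: e[symmetric] S.r_distr)
    finally have "val (U \<otimes>\<^bsub>R\<^esub> P1 \<oplus>\<^bsub>R\<^esub> V \<otimes>\<^bsub>R\<^esub> P2, U \<otimes>\<^bsub>R\<^esub> Q1) = class_val A \<oplus>\<^bsub>M\<^esub> class_val B"
      using val_eq_iff[OF fr] a b by simp
    with fr Z show ?thesis by blast
  qed
  from Union_fractions[OF ne this] show ?thesis unfolding AB by blast
qed

lemma one_nonzero: "\<one>\<^bsub>R\<^esub> \<noteq> \<zero>\<^bsub>R\<^esub>"
  using nontrivial hom_one hom_zero by metis

lemma class_val_frac_embed: "p \<in> carrier R \<Longrightarrow> class_val (frac_embed R p) = h p"
  using one_nonzero
  by (simp add: frac_embed_def class_val_fraction fractions_def val_eq_iff)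

lemma frac_embed_closed: "p \<in> carrier R \<Longrightarrow> frac_embed R p \<in> carrier (skew_fraction_field R)"
  using one_nonzero by (simp add: frac_embed_def fraction_closed fractions_def)

theorem skew_fraction_field_embeds:
  "ring_hom_ring (skew_fraction_field R) M class_val"
proof -
  have zero: "\<zero>\<^bsub>skew_fraction_field R\<^esub> = frac_embed R \<zero>\<^bsub>R\<^esub>"
    and one: "\<one>\<^bsub>skew_fraction_field R\<^esub> = frac_embed R \<one>\<^bsub>R\<^esub>"
    by (simp_all add: skew_fraction_field_def frac_embed_def)
  have hom: "class_val \<in> ring_hom (skew_fraction_field R) M"
    by (rule ring_hom_memI)
      (simp_all add: class_val_closed mult_class add_class one class_val_frac_embed)
  have "ring (skew_fraction_field R)"
  proof (rule ring_if_embeds[OF S.ring_axioms class_val_inj hom])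
    fix A assume "A \<in> carrier (skew_fraction_field R)"
    then obtain p q where pq: "(p, q) \<in> fractions R" "A = fraction R p q"
      by (rule carrier_skew_fraction_fieldE)
    then have f: "(\<ominus>\<^bsub>R\<^esub> p, q) \<in> fractions R" by (simp add: fractions_def)
    have "val (\<ominus>\<^bsub>R\<^esub> p, q) = \<ominus>\<^bsub>M\<^esub> val (p, q)"
      using pq by (simp add: val_def fractions_def hom_unit S.r_minus)
    then show "\<exists>B \<in> carrier (skew_fraction_field R). class_val B = \<ominus>\<^bsub>M\<^esub> class_val A"
      using f pq by (intro bexI[of _ "fraction R (\<ominus>\<^bsub>R\<^esub> p) q"])
        (simp_all add: fraction_closed class_val_fraction)
  qed (simp_all add: zero one frac_embed_closed class_val_frac_embed mult_class add_class)
  then show ?thesis using hom S.ring_axioms by (intro ring_hom_ringI2)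
qed

end


section \<open>The Calkin algebra of a vector space\<close>

locale linear_subspace = ring R for R (structure) and K V +
  assumes K: "subfield K R" and V: "subalgebra K V R"
begin

abbreviation "E \<equiv> lin_end R K V"
abbreviation "I \<equiv> finite_rank R K V"

lemma subalgebra_facts:
  assumes "subalgebra K W R"
  shows "W \<subseteq> carrier R" "\<zero> \<in> W" "\<And>x y. \<lbrakk> x \<in> W; y \<in> W \<rbrakk> \<Longrightarrow> x \<oplus> y \<in> W"
    "\<And>x. x \<in> W \<Longrightarrow> \<ominus> x \<in> W" "\<And>k x. \<lbrakk> k \<in> K; x \<in> W \<rbrakk> \<Longrightarrow> k \<otimes> x \<in> W"
  using subalgebra.axioms(1)[OF assms] subalgebra.smult_closed[OF assms]
    subalgebra_in_carrier[OF assms]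
  by (auto simp: subgroup.one_closed[of W "add_monoid R", simplified] add.subgroupE(4)
      add.subgroupE(3) a_inv_def[symmetric])

lemmas V_facts = subalgebra_facts[OF V]

lemma V_carrier: "x \<in> V \<Longrightarrow> x \<in> carrier R"
  using V_facts(1) by blast

lemma K_carrier: "k \<in> K \<Longrightarrow> k \<in> carrier R"
  using subfieldE(3)[OF K] by blast

text \<open>
  Negatives come for free, as multiples by the scalar \<open>-1\<close>.
\<close>

lemma subalgebraI:
  assumes "W \<subseteq> carrier R" "\<zero> \<in> W" "\<And>x y. \<lbrakk> x \<in> W; y \<in> W \<rbrakk> \<Longrightarrow> x \<oplus> y \<in> W"
    "\<And>k x. \<lbrakk> k \<in> K; x \<in> W \<rbrakk> \<Longrightarrow> k \<otimes> x \<in> W"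
  shows "subalgebra K W R"
proof (intro subalgebra.intro subalgebra_axioms.intro assms(4))
  show "subgroup W (add_monoid R)"
  proof (rule add.subgroupI)
    fix x assume x: "x \<in> W"
    have "\<ominus> \<one> \<otimes> x \<in> W"
      using assms(4)[OF _ x] subringE(5)[OF subfieldE(1)[OF K]] subringE(3)[OF subfieldE(1)[OF K]] by blast
    then show "\<ominus> x \<in> W" using x assms(1) by (simp add: l_minus subset_iff)
  qed (use assms in auto)
qed

lemma lin_end_iff:
  "f \<in> carrier E \<longleftrightarrow> f \<in> V \<rightarrow>\<^sub>E V \<and> (\<forall>x \<in> V. \<forall>y \<in> V. f (x \<oplus> y) = f x \<oplus> f y) \<and>
    (\<forall>k \<in> K. \<forall>x \<in> V. f (k \<otimes> x) = k \<otimes> f x)"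
  by (simp add: lin_end_def)

lemma lin_endI:
  assumes "\<And>x. x \<in> V \<Longrightarrow> f x \<in> V" "\<And>x y. \<lbrakk> x \<in> V; y \<in> V \<rbrakk> \<Longrightarrow> f (x \<oplus> y) = f x \<oplus> f y"
    "\<And>k x. \<lbrakk> k \<in> K; x \<in> V \<rbrakk> \<Longrightarrow> f (k \<otimes> x) = k \<otimes> f x"
  shows "restrict f V \<in> carrier E"
  using assms by (auto simp: lin_end_iff V_facts)

lemma lin_endD:
  assumes "f \<in> carrier E"
  shows "x \<in> V \<Longrightarrow> f x \<in> V" "\<lbrakk> x \<in> V; y \<in> V \<rbrakk> \<Longrightarrow> f (x \<oplus> y) = f x \<oplus> f y"
    "\<lbrakk> k \<in> K; x \<in> V \<rbrakk> \<Longrightarrow> f (k \<otimes> x) = k \<otimes> f x" "f \<in> extensional V"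
  using assms by (auto simp: lin_end_iff PiE_def)

lemma lin_end_eqI:
  assumes "f \<in> carrier E" "g \<in> carrier E" "\<And>x. x \<in> V \<Longrightarrow> f x = g x"
  shows "f = g"
  using extensionalityI[OF lin_endD(4)[OF assms(1)] lin_endD(4)[OF assms(2)]] assms(3) by blast

lemma lin_end_zero: "f \<in> carrier E \<Longrightarrow> f \<zero> = \<zero>"
  using lin_endD(2)[of f \<zero> \<zero>] V_facts(2) lin_endD(1)[of f \<zero>] V_carrier by simp

lemma lin_end_minus: "\<lbrakk> f \<in> carrier E; x \<in> V \<rbrakk> \<Longrightarrow> f (\<ominus> x) = \<ominus> f x"
  using lin_endD(2)[of f "\<ominus> x" x] lin_end_zero[of f] V_facts(4) lin_endD(1)[of f] V_carrier
  by (metis l_neg minus_equality)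

lemma lin_end_apply [simp]:
  "x \<in> V \<Longrightarrow> (f \<otimes>\<^bsub>E\<^esub> g) x = f (g x)" "x \<in> V \<Longrightarrow> (f \<oplus>\<^bsub>E\<^esub> g) x = f x \<oplus> g x"
  "x \<in> V \<Longrightarrow> \<one>\<^bsub>E\<^esub> x = x" "x \<in> V \<Longrightarrow> \<zero>\<^bsub>E\<^esub> x = \<zero>"
  by (simp_all add: lin_end_def compose_eq)

lemma lin_end_closed:
  "\<lbrakk> f \<in> carrier E; g \<in> carrier E \<rbrakk> \<Longrightarrow> f \<otimes>\<^bsub>E\<^esub> g \<in> carrier E"
  "\<lbrakk> f \<in> carrier E; g \<in> carrier E \<rbrakk> \<Longrightarrow> f \<oplus>\<^bsub>E\<^esub> g \<in> carrier E"
  "\<one>\<^bsub>E\<^esub> \<in> carrier E" "\<zero>\<^bsub>E\<^esub> \<in> carrier E"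
proof -
  assume f: "f \<in> carrier E" and g: "g \<in> carrier E"
  note D = lin_endD[OF f] lin_endD[OF g]
  have "restrict (\<lambda>x. f (g x)) V \<in> carrier E"
    by (rule lin_endI) (simp_all add: D)
  then show "f \<otimes>\<^bsub>E\<^esub> g \<in> carrier E" by (simp add: lin_end_def compose_def)
  have "restrict (\<lambda>x. f x \<oplus> g x) V \<in> carrier E"
    by (rule lin_endI) (simp_all add: D V_facts V_carrier K_carrier a_ac r_distr)
  then show "f \<oplus>\<^bsub>E\<^esub> g \<in> carrier E" by (simp add: lin_end_def)
next
  have "restrict (\<lambda>x. x) V \<in> carrier E" by (rule lin_endI) simp_all
  then show "\<one>\<^bsub>E\<^esub> \<in> carrier E" by (simp add: lin_end_def)
  have "restrict (\<lambda>x. \<zero>) V \<in> carrier E" by (rule lin_endI) (simp_all add: V_facts K_carrier)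
  then show "\<zero>\<^bsub>E\<^esub> \<in> carrier E" by (simp add: lin_end_def)
qed

lemma lin_end_neg:
  assumes "f \<in> carrier E"
  shows "restrict (\<lambda>x. \<ominus> f x) V \<in> carrier E"
  by (rule lin_endI)
    (simp_all add: lin_endD[OF assms] V_facts V_carrier K_carrier minus_add r_minus)

lemma lin_end_ring: "ring E"
proof (intro ringI abelian_groupI monoidI)
  fix f assume f: "f \<in> carrier E"
  show "\<exists>g \<in> carrier E. g \<oplus>\<^bsub>E\<^esub> f = \<zero>\<^bsub>E\<^esub>"
    by (rule bexI[OF _ lin_end_neg[OF f]], rule lin_end_eqI)
      (simp_all add: f lin_end_closed lin_end_neg l_neg V_carrier lin_endD[OF f])
qed (auto intro!: lin_end_eqI simp: lin_end_closed lin_endD V_carrier a_ac)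

lemma lin_end_a_inv:
  assumes "f \<in> carrier E" "x \<in> V"
  shows "(\<ominus>\<^bsub>E\<^esub> f) x = \<ominus> f x"
proof -
  interpret E: ring E by (rule lin_end_ring)
  have "\<ominus>\<^bsub>E\<^esub> f = restrict (\<lambda>x. \<ominus> f x) V"
    by (rule E.minus_equality[OF _ assms(1) lin_end_neg[OF assms(1)]], rule lin_end_eqI)
      (simp_all add: assms lin_end_closed lin_end_neg l_neg V_carrier lin_endD[OF assms(1)])
  then show ?thesis using assms(2) by simp
qed

text \<open>
  This is what makes images of finite-dimensional spaces finite-dimensional: the images of a
  spanning list span the image.
\<close>

lemma lin_end_image_Span:
  assumes f: "f \<in> carrier E" and "set Us \<subseteq> V"
  shows "f ` Span K Us = Span K (map f Us)"
  using assms(2)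
proof (induct Us)
  case Nil
  then show ?case by (simp add: lin_end_zero[OF f])
next
  case (Cons u Us)
  have sub: "Span K Us \<subseteq> V" using Cons.prems by (intro subalgebra_Span_incl[OF K V]) auto
  have u: "u \<in> V" using Cons.prems by simp
  have step: "f (k \<otimes> u \<oplus> v) = k \<otimes> f u \<oplus> f v" if "k \<in> K" "v \<in> Span K Us" for k v
    using that u sub lin_endD(2,3)[OF f] V_facts(5) by (metis subsetD)
  have IH: "f ` Span K Us = Span K (map f Us)" using Cons by simp
  have "f ` line_extension K u (Span K Us) = line_extension K (f u) (f ` Span K Us)" (is "?l = ?r")
  proof
    show "?l \<subseteq> ?r" using step by (fastforce simp: line_extension_mem_iff simp del: Span.simps)
    show "?r \<subseteq> ?l"
    proof
      fix y assume "y \<in> ?r"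
      then obtain k v where kv: "k \<in> K" "v \<in> Span K Us" "y = k \<otimes> f u \<oplus> f v"
        by (auto simp: line_extension_mem_iff simp del: Span.simps)
      have "k \<otimes> u \<oplus> v \<in> line_extension K u (Span K Us)"
        using kv(1,2) line_extension_mem_iff by blast
      moreover have "y = f (k \<otimes> u \<oplus> v)" using step kv by simp
      ultimately show "y \<in> ?l" by blast
    qed
  qed
  then show ?case using IH by simp
qed

lemma image_subalgebra:
  assumes f: "f \<in> carrier E" and W: "subalgebra K W R" "W \<subseteq> V"
  shows "subalgebra K (f ` W) R"
proof (rule subalgebraI)
  note w = subalgebra_facts[OF W(1)]
  show "f ` W \<subseteq> carrier R" using lin_endD(1)[OF f] W(2) V_carrier by blast
  show "\<zero> \<in> f ` W" using lin_end_zero[OF f] w(2) by force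
  show "x \<oplus> y \<in> f ` W" if "x \<in> f ` W" "y \<in> f ` W" for x y
    using that lin_endD(2)[OF f] W(2) w(3) by (smt (verit) image_iff subsetD)
  show "k \<otimes> x \<in> f ` W" if "k \<in> K" "x \<in> f ` W" for k x
    using that lin_endD(3)[OF f] W(2) w(5) by (smt (verit) image_iff subsetD)
qed

lemma finite_dimension_image:
  assumes f: "f \<in> carrier E" and W: "finite_dimension K W" "W \<subseteq> V"
  shows "finite_dimension K (f ` W)"
proof -
  obtain n where "dimension n K W" using W(1) by auto
  then obtain Us where Us: "set Us \<subseteq> carrier R" "Span K Us = W" using exists_base[OF K] by blast
  then have "set Us \<subseteq> V" using Span_base_incl[OF K Us(1)] W(2) by blast
  then have "f ` W = Span K (map f Us)" and "set (map f Us) \<subseteq> carrier R"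
    using lin_end_image_Span[OF f, of Us] Us(2) lin_endD(1)[OF f] V_carrier by auto
  then show ?thesis using Span_finite_dimension[OF K] by metis
qed

text \<open>
  The rank need not be computed: a finite-dimensional space containing the image is enough, since
  subspaces of finite-dimensional spaces are finite-dimensional.
\<close>

lemma finite_rankI:
  assumes "f \<in> carrier E" "finite_dimension K W" "f ` V \<subseteq> W"
  shows "f \<in> I"
  using assms subalbegra_incl_imp_finite_dimension[OF K assms(2) image_subalgebra[OF assms(1) V]]
  by (simp add: finite_rank_def)

lemma finite_rankD:
  assumes "f \<in> I"
  shows "f \<in> carrier E" "finite_dimension K (f ` V)"
  using assms by (simp_all add: finite_rank_def)

lemma finite_rank_ideal: "ideal I E"
proof (rule idealI[OF lin_end_ring])
  interpret E: ring E by (rule lin_end_ring)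
  have zero: "\<zero>\<^bsub>E\<^esub> \<in> I"
    by (rule finite_rankI[of _ "{\<zero>}"])
      (auto simp: lin_end_closed intro: finite_dimensionI)
  show "subgroup I (add_monoid E)"
  proof (rule E.add.subgroupI)
    show "I \<subseteq> carrier E" using finite_rankD(1) by blast
    show "I \<noteq> {}" using zero by blast
  next
    fix f assume f: "f \<in> I"
    note f' = finite_rankD[OF f]
    have "(\<ominus>\<^bsub>E\<^esub> f) ` V \<subseteq> f ` V"
      using subalgebra_facts(4)[OF image_subalgebra[OF f'(1) V]] by (auto simp: lin_end_a_inv f')
    then show "\<ominus>\<^bsub>E\<^esub> f \<in> I" by (intro finite_rankI[OF _ f'(2)] E.a_inv_closed f')
  next
    fix f g assume f: "f \<in> I" and g: "g \<in> I"
    note f' = finite_rankD[OF f] and g' = finite_rankD[OF g]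
    have "(f \<oplus>\<^bsub>E\<^esub> g) ` V \<subseteq> f ` V <+>\<^bsub>R\<^esub> g ` V"
      by (auto simp: set_add_def')
    then show "f \<oplus>\<^bsub>E\<^esub> g \<in> I"
      by (intro finite_rankI[OF _ sum_space_dim(1)[OF K f'(2) g'(2)]] lin_end_closed f' g')
  qed
next
  fix f g assume f: "f \<in> I" and g: "g \<in> carrier E"
  note f' = finite_rankD[OF f]
  have "f ` V \<subseteq> V" using lin_endD(1)[OF f'(1)] by blast
  then show "g \<otimes>\<^bsub>E\<^esub> f \<in> I"
    by (intro finite_rankI[OF _ finite_dimension_image[OF g f'(2)]] lin_end_closed f' g) auto
  show "f \<otimes>\<^bsub>E\<^esub> g \<in> I"
    by (intro finite_rankI[OF _ f'(2)] lin_end_closed f' g) (auto simp: lin_endD[OF g])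
qed

lemma calkin_hom: "ring_hom_ring E (calkin_algebra R K V) ((+>\<^bsub>E\<^esub>) I)"
  unfolding calkin_algebra_def by (rule ideal.rcos_ring_hom_ring[OF finite_rank_ideal])

lemma calkin_eq_iff:
  assumes "f \<in> carrier E" "g \<in> carrier E"
  shows "I +>\<^bsub>E\<^esub> f = I +>\<^bsub>E\<^esub> g \<longleftrightarrow> f \<ominus>\<^bsub>E\<^esub> g \<in> I"
proof -
  interpret E: ring E by (rule lin_end_ring)
  show ?thesis using E.quotient_eq_iff_same_a_r_cos[OF finite_rank_ideal assms] by simp
qed

lemma calkin_nontrivial:
  assumes "infinite_dimension K V"
  shows "\<one>\<^bsub>calkin_algebra R K V\<^esub> \<noteq> \<zero>\<^bsub>calkin_algebra R K V\<^esub>"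
proof
  interpret E: ring E by (rule lin_end_ring)
  interpret h: ring_hom_ring E "calkin_algebra R K V" "(+>\<^bsub>E\<^esub>) I" by (rule calkin_hom)
  assume "\<one>\<^bsub>calkin_algebra R K V\<^esub> = \<zero>\<^bsub>calkin_algebra R K V\<^esub>"
  then have "I +>\<^bsub>E\<^esub> \<one>\<^bsub>E\<^esub> = I +>\<^bsub>E\<^esub> \<zero>\<^bsub>E\<^esub>" using h.hom_one h.hom_zero by metis
  then have "\<one>\<^bsub>E\<^esub> \<in> I"
    using calkin_eq_iff[of "\<one>\<^bsub>E\<^esub>" "\<zero>\<^bsub>E\<^esub>"] by (simp add: a_minus_def)
  then have "finite_dimension K (\<one>\<^bsub>E\<^esub> ` V)" by (rule finite_rankD)
  moreover have "\<one>\<^bsub>E\<^esub> ` V = V" by (auto simp: image_iff)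
  ultimately show False using assms by simp
qed

text \<open>
  By Zorn's lemma there is a maximal subspace \<open>W\<close> meeting \<open>N\<close> trivially. For \<open>x\<close> outside \<open>W\<close>, the
  larger space \<open>W + K x\<close> contains some \<open>y \<noteq> 0\<close> of \<open>N\<close>; the coefficient of \<open>x\<close> in \<open>y\<close> is not zero, so
  \<open>x\<close> can be solved for and lies in \<open>W + N\<close>.
\<close>

lemma complement_exists:
  assumes N: "subalgebra K N R" "N \<subseteq> V"
  obtains W where "subalgebra K W R" "W \<subseteq> V" "W \<inter> N = {\<zero>}"
    "\<And>x. x \<in> V \<Longrightarrow> \<exists>w \<in> W. \<exists>n \<in> N. x = w \<oplus> n"
proof -
  define \<A> where "\<A> = {W. subalgebra K W R \<and> W \<subseteq> V \<and> W \<inter> N = {\<zero>}}"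
  have ne: "{\<zero>} \<in> \<A>"
    using subalgebra_facts(2)[OF N(1)] V_facts(2)
    by (auto simp: \<A>_def K_carrier intro!: subalgebraI)
  have "\<exists>W \<in> \<A>. \<forall>Y \<in> \<A>. W \<subseteq> Y \<longrightarrow> Y = W"
  proof (rule subset_Zorn_nonempty)
    show "\<A> \<noteq> {}" using ne by blast
    fix \<C> assume \<C>: "\<C> \<noteq> {}" "subset.chain \<A> \<C>"
    have mem: "subalgebra K W R" "W \<subseteq> V" "W \<inter> N = {\<zero>}" if "W \<in> \<C>" for W
      using \<C>(2) that by (auto simp: subset.chain_def \<A>_def)
    have common: "\<exists>W \<in> \<C>. x \<in> W \<and> y \<in> W" if "x \<in> \<Union> \<C>" "y \<in> \<Union> \<C>" for x y
      using that \<C>(2) unfolding subset_chain_def by blast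
    have "subalgebra K (\<Union> \<C>) R"
    proof (rule subalgebraI)
      show "\<Union> \<C> \<subseteq> carrier R" using mem(2) V_facts(1) by (meson Union_least subset_trans)
      show "\<zero> \<in> \<Union> \<C>" using \<C>(1) mem(3) by fast
      show "x \<oplus> y \<in> \<Union> \<C>" if "x \<in> \<Union> \<C>" "y \<in> \<Union> \<C>" for x y
        using common[OF that] subalgebra_facts(3)[OF mem(1)] by (meson UnionI)
      show "k \<otimes> x \<in> \<Union> \<C>" if "k \<in> K" "x \<in> \<Union> \<C>" for k x
        using that subalgebra_facts(5)[OF mem(1)] by (meson UnionE UnionI)
    qed
    moreover have "\<Union> \<C> \<subseteq> V" "\<Union> \<C> \<inter> N = {\<zero>}" using mem(2,3) \<C>(1) by fast+
    ultimately show "\<Union> \<C> \<in> \<A>" by (simp add: \<A>_def)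
  qed
  then obtain W where "W \<in> \<A>" and max: "\<And>Y. \<lbrakk> Y \<in> \<A>; W \<subseteq> Y \<rbrakk> \<Longrightarrow> Y = W"
    by blast
  then have W: "subalgebra K W R" "W \<subseteq> V" "W \<inter> N = {\<zero>}"
    by (simp_all add: \<A>_def)
  note w = subalgebra_facts[OF W(1)] and n = subalgebra_facts[OF N(1)]
  have "\<exists>w \<in> W. \<exists>n \<in> N. x = w \<oplus> n" if x: "x \<in> V" for x
  proof (cases "x \<in> W")
    case True
    then show ?thesis using n(2) V_carrier[OF x] by (intro bexI[of _ x] bexI[of _ \<zero>]) auto
  next
    case False
    let ?L = "line_extension K x W"
    have xc: "x \<in> carrier R" using V_carrier x by blast
    have incl: "W \<subseteq> ?L"
    proof
      fix y assume "y \<in> W"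
      moreover have "\<zero> \<in> K" using subringE(2)[OF subfieldE(1)[OF K]] .
      moreover have "y = \<zero> \<otimes> x \<oplus> y" using xc w(1) \<open>y \<in> W\<close> by auto
      ultimately show "y \<in> ?L" unfolding line_extension_mem_iff by blast
    qed
    have "x = \<one> \<otimes> x \<oplus> \<zero>" using xc by simp
    then have "x \<in> ?L"
      using subringE(3)[OF subfieldE(1)[OF K]] w(2) line_extension_mem_iff by blast
    then have "?L \<notin> \<A>" using max[OF _ incl] False by blast
    moreover have "subalgebra K ?L R"
      using line_extension_is_subgroup[OF K subalgebra.axioms(1)[OF W(1)] xc]
        line_extension_smult_closed[OF K w(5,1) xc]
      by (intro subalgebra.intro subalgebra_axioms.intro)
    moreover have "?L \<subseteq> V"
      using x V_facts(3,5) subsetD[OF W(2)] by (auto simp: line_extension_mem_iff)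
    ultimately have "?L \<inter> N \<noteq> {\<zero>}" by (simp add: \<A>_def)
    moreover have "\<zero> \<in> ?L \<inter> N" using incl w(2) n(2) by blast
    ultimately obtain y where y: "y \<in> ?L" "y \<in> N" "y \<noteq> \<zero>" by blast
    then obtain k v where kv: "k \<in> K" "v \<in> W" "y = k \<otimes> x \<oplus> v"
      by (auto simp: line_extension_mem_iff)
    have c: "k \<in> carrier R" "v \<in> carrier R" "y \<in> carrier R"
      using K_carrier kv(1,2) w(1) y(2) n(1) by auto
    have "k \<noteq> \<zero>"
    proof
      assume "k = \<zero>"
      then have "y = v" using kv c xc by simp
      then show False using y kv(2) W(3) by blast
    qed
    then have k: "inv k \<in> K" "inv k \<otimes> k = \<one>" using subfield_m_inv[OF K] kv(1) by auto
    have "x = (inv k \<otimes> k) \<otimes> x" using k(2) xc by simp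
    also have "\<dots> = inv k \<otimes> (y \<oplus> \<ominus> v)"
      using c xc k(1)[THEN K_carrier] by (simp add: kv(3) m_assoc a_assoc r_neg)
    also have "\<dots> = inv k \<otimes> (\<ominus> v) \<oplus> inv k \<otimes> y"
      using c k(1)[THEN K_carrier] by (simp add: r_distr a_comm)
    finally show ?thesis using k(1) w(4,5) n(5) kv(2) y(2) by blast
  qed
  with W show thesis by (rule that)
qed

text \<open>
  A surjection restricts to a bijection on every complement of its kernel; the section is the
  inverse of this bijection. It is linear because preimages in the complement are unique.
\<close>

lemma linear_section:
  assumes f: "f \<in> carrier E" and onto: "f ` V = V"
  obtains s where "s \<in> carrier E" "\<And>y. y \<in> V \<Longrightarrow> f (s y) = y"
proof -
  define N where "N = {x \<in> V. f x = \<zero>}"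
  have "subalgebra K N R"
    by (rule subalgebraI)
      (auto simp: N_def V_carrier V_facts lin_endD[OF f] lin_end_zero[OF f] K_carrier)
  then obtain W where W: "subalgebra K W R" "W \<subseteq> V" "W \<inter> N = {\<zero>}"
    and dec: "\<And>x. x \<in> V \<Longrightarrow> \<exists>w \<in> W. \<exists>n \<in> N. x = w \<oplus> n"
    by (rule complement_exists) (auto simp: N_def)
  note w = subalgebra_facts[OF W(1)]
  have uniq: "x = y" if "x \<in> W" "y \<in> W" "f x = f y" for x y
  proof -
    have v: "x \<in> V" "y \<in> V" using that W(2) by auto
    have "f (x \<oplus> \<ominus> y) = \<zero>"
      using that v V_facts(4) lin_endD(1)[OF f] V_carrier
      by (simp add: lin_endD(2)[OF f] lin_end_minus[OF f] r_neg)
    then have "x \<oplus> \<ominus> y \<in> W \<inter> N" using that w(3,4) W(2) by (auto simp: N_def)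
    then have "x \<ominus> y = \<zero>" using W(3) by (auto simp: a_minus_def)
    then show ?thesis using v V_carrier by simp
  qed
  have ex: "\<exists>x \<in> W. f x = y" if y: "y \<in> V" for y
  proof -
    obtain x where x: "x \<in> V" "f x = y" using onto y by (metis imageE)
    obtain u n where un: "u \<in> W" "n \<in> N" "x = u \<oplus> n" using dec[OF x(1)] by blast
    then have v: "u \<in> V" "n \<in> V" "f n = \<zero>" using W(2) by (auto simp: N_def)
    then have "f x = f u"
      using lin_endD(1)[OF f v(1)] V_carrier by (simp add: un(3) lin_endD(2)[OF f])
    then show ?thesis using un(1) x(2) by metis
  qed
  define s where "s = (\<lambda>y. SOME x. x \<in> W \<and> f x = y)"
  have s: "s y \<in> W" "f (s y) = y" if "y \<in> V" for y
    using someI_ex[of "\<lambda>x. x \<in> W \<and> f x = y"] ex[OF that] unfolding s_def by (metis (lifting))+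
  have sV: "s y \<in> V" if "y \<in> V" for y using s(1)[OF that] W(2) by (rule subsetD[rotated])
  have "restrict s V \<in> carrier E"
  proof (rule lin_endI)
    show "s (x \<oplus> y) = s x \<oplus> s y" if "x \<in> V" "y \<in> V" for x y
      by (rule uniq) (use that in \<open>simp_all add: s sV w V_facts lin_endD[OF f]\<close>)
    show "s (k \<otimes> x) = k \<otimes> s x" if "k \<in> K" "x \<in> V" for k x
      by (rule uniq) (use that in \<open>simp_all add: s sV w V_facts lin_endD[OF f]\<close>)
  qed (rule sV)
  then show thesis by (rule that) (simp add: s(2))
qed

text \<open>
  A linear section \<open>s\<close> is a right inverse of \<open>f\<close>. From \<open>f (s (f x) - x) = 0\<close> it follows that
  \<open>s f - 1\<close> maps into the kernel of \<open>f\<close>, so modulo maps of finite rank \<open>s\<close> is a left inverse, too.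
\<close>

theorem calkin_unit:
  assumes f: "f \<in> carrier E" and onto: "f ` V = V"
    and ker: "finite_dimension K {x \<in> V. f x = \<zero>}"
  shows "I +>\<^bsub>E\<^esub> f \<in> Units (calkin_algebra R K V)"
proof -
  interpret E: ring E by (rule lin_end_ring)
  interpret h: ring_hom_ring E "calkin_algebra R K V" "(+>\<^bsub>E\<^esub>) I" by (rule calkin_hom)
  obtain s where s: "s \<in> carrier E" "\<And>y. y \<in> V \<Longrightarrow> f (s y) = y"
    using linear_section[OF f onto] by blast
  have fs: "f \<otimes>\<^bsub>E\<^esub> s = \<one>\<^bsub>E\<^esub>"
    by (rule lin_end_eqI) (simp_all add: f s)
  have c: "s \<otimes>\<^bsub>E\<^esub> f \<ominus>\<^bsub>E\<^esub> \<one>\<^bsub>E\<^esub> \<in> carrier E" using f s by simp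
  have "(s \<otimes>\<^bsub>E\<^esub> f \<ominus>\<^bsub>E\<^esub> \<one>\<^bsub>E\<^esub>) x \<in> {x \<in> V. f x = \<zero>}" if "x \<in> V" for x
  proof -
    note v = lin_endD(1)[OF f that] lin_endD(1)[OF s(1) lin_endD(1)[OF f that]]
    have "(s \<otimes>\<^bsub>E\<^esub> f \<ominus>\<^bsub>E\<^esub> \<one>\<^bsub>E\<^esub>) x = s (f x) \<oplus> \<ominus> x"
      using that by (simp add: a_minus_def lin_end_a_inv)
    moreover have "f (s (f x) \<oplus> \<ominus> x) = \<zero>"
      using that v V_facts(4) V_carrier
      by (simp add: lin_endD(2)[OF f] lin_end_minus[OF f] s r_neg)
    ultimately show ?thesis using v that V_facts(3,4) by simp
  qed
  then have "s \<otimes>\<^bsub>E\<^esub> f \<ominus>\<^bsub>E\<^esub> \<one>\<^bsub>E\<^esub> \<in> I"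
    by (intro finite_rankI[OF c ker]) blast
  then have "I +>\<^bsub>E\<^esub> (s \<otimes>\<^bsub>E\<^esub> f) = I +>\<^bsub>E\<^esub> \<one>\<^bsub>E\<^esub>"
    using f s(1) by (intro calkin_eq_iff[THEN iffD2]) simp_all
  then have "(I +>\<^bsub>E\<^esub> s) \<otimes>\<^bsub>calkin_algebra R K V\<^esub> (I +>\<^bsub>E\<^esub> f) = \<one>\<^bsub>calkin_algebra R K V\<^esub>"
    using f s by (metis h.hom_mult h.hom_one)
  moreover have "(I +>\<^bsub>E\<^esub> f) \<otimes>\<^bsub>calkin_algebra R K V\<^esub> (I +>\<^bsub>E\<^esub> s) = \<one>\<^bsub>calkin_algebra R K V\<^esub>"
    using f s fs by (metis h.hom_mult h.hom_one)
  ultimately show ?thesis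
    using f s h.hom_closed unfolding Units_def by blast
qed

end


section \<open>Differential operators acting on a differential field\<close>

context differential_field
begin

abbreviation "const_field \<equiv> constants F \<delta>"
abbreviation "D \<equiv> D_times F \<delta>"
abbreviation "ops \<equiv> diff_ops F \<delta>"

lemma deriv_zero [simp]: "\<delta> \<zero> = \<zero>"
  using deriv_add[of \<zero> \<zero>] deriv_closed[of \<zero>] by simp

lemma deriv_one [simp]: "\<delta> \<one> = \<zero>"
  using deriv_mult[of \<one> \<one>] deriv_closed[of \<one>] by simp

lemma deriv_minus: "a \<in> carrier F \<Longrightarrow> \<delta> (\<ominus> a) = \<ominus> \<delta> a"
  using deriv_add[of "\<ominus> a" a] deriv_closed by (metis a_inv_closed deriv_zero l_neg minus_equality)

lemma iter_deriv_closed [simp]: "a \<in> carrier F \<Longrightarrow> (\<delta> ^^ i) a \<in> carrier F"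
  by (induct i) (simp_all add: deriv_closed)

lemma iter_deriv_add:
  "\<lbrakk> a \<in> carrier F; b \<in> carrier F \<rbrakk> \<Longrightarrow> (\<delta> ^^ i) (a \<oplus> b) = (\<delta> ^^ i) a \<oplus> (\<delta> ^^ i) b"
  by (induct i) (simp_all add: deriv_add)

lemma iter_deriv_const:
  "\<lbrakk> c \<in> const_field; a \<in> carrier F \<rbrakk> \<Longrightarrow> (\<delta> ^^ i) (c \<otimes> a) = c \<otimes> (\<delta> ^^ i) a"
  by (induct i) (simp_all add: deriv_mult deriv_closed constants_def)

text \<open>
  Inverses of constants are constants: differentiating \<open>k k\<^sup>-\<^sup>1 = 1\<close> gives \<open>k \<delta>(k\<^sup>-\<^sup>1) = 0\<close>.
\<close>

lemma const_subfield: "subfield const_field F"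
proof (rule subfieldI')
  show "subring const_field F"
    by (rule subringI)
      (auto simp: constants_def deriv_minus deriv_add deriv_mult)
  fix k assume "k \<in> const_field - {\<zero>}"
  then have k: "k \<in> carrier F" "\<delta> k = \<zero>" "k \<noteq> \<zero>" by (auto simp: constants_def)
  then have u: "k \<in> Units F" by (simp add: field_Units)
  then have "k \<otimes> \<delta> (inv k) = \<delta> (k \<otimes> inv k)"
    using k by (simp add: deriv_mult deriv_closed del: Units_r_inv)
  also have "\<dots> = \<zero>" using u by simp
  finally have "\<delta> (inv k) = \<zero>"
    using k deriv_closed[OF Units_inv_closed[OF u]] integral[of k "\<delta> (inv k)"] by simp
  then show "inv k \<in> const_field" using u by (simp add: constants_def)
qed

sublocale lin: linear_subspace F const_field "carrier F"
  by (intro linear_subspace.intro linear_subspace_axioms.intro ring_axioms const_subfield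
      carrier_is_subalgebra subfieldE(3))

abbreviation "Calkin \<equiv> calkin_algebra F const_field (carrier F)"

subsection \<open>Coefficients and degrees\<close>

lemma ops_simps:
  "carrier ops = up F" "\<zero>\<^bsub>ops\<^esub> = (\<lambda>i. \<zero>)" "\<one>\<^bsub>ops\<^esub> = (\<lambda>i. if i = 0 then \<one> else \<zero>)"
  "\<lbrakk> P \<in> up F; Q \<in> up F \<rbrakk> \<Longrightarrow> P \<oplus>\<^bsub>ops\<^esub> Q = (\<lambda>i. P i \<oplus> Q i)"
  "\<lbrakk> P \<in> up F; Q \<in> up F \<rbrakk> \<Longrightarrow> P \<otimes>\<^bsub>ops\<^esub> Q = (\<lambda>n. \<Oplus>i \<in> {..deg F P}. P i \<otimes> (D ^^ i) Q n)"
  by (simp_all add: diff_ops_def UP_def)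

lemma upI: "\<lbrakk> \<And>i. P i \<in> carrier F; \<And>i. n < i \<Longrightarrow> P i = \<zero> \<rbrakk> \<Longrightarrow> P \<in> up F"
  by (rule mem_upI) (auto intro!: exI[of _ n])

lemma coeff_closed [simp]: "P \<in> up F \<Longrightarrow> P i \<in> carrier F"
  by (rule mem_upD)

lemma deg_eq_Least: "P \<in> up F \<Longrightarrow> deg F P = (LEAST n. bound \<zero> n P)"
  by (simp add: deg_def UP_def)

lemma bound_deg: "P \<in> up F \<Longrightarrow> bound \<zero> (deg F P) P"
  using LeastI_ex[of "\<lambda>n. bound \<zero> n P"] by (simp add: deg_eq_Least bound_upD)

lemma coeff_above_deg: "\<lbrakk> P \<in> up F; deg F P < i \<rbrakk> \<Longrightarrow> P i = \<zero>"
  by (rule bound.bound[OF bound_deg])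

lemma deg_leI:
  assumes "P \<in> up F" "\<And>i. n < i \<Longrightarrow> P i = \<zero>"
  shows "deg F P \<le> n"
  unfolding deg_eq_Least[OF assms(1)] by (rule Least_le) (rule bound.intro, rule assms(2))

lemma lead_coeff_nonzero:
  assumes P: "P \<in> up F" and nz: "P \<noteq> (\<lambda>i. \<zero>)"
  shows "P (deg F P) \<noteq> \<zero>"
proof
  assume z: "P (deg F P) = \<zero>"
  have vanish: "P i = \<zero>" if "deg F P - 1 < i" for i
    using coeff_above_deg[OF P, of i] z that by (cases "i = deg F P") auto
  then have "deg F P \<le> deg F P - 1" by (rule deg_leI[OF P])
  then have "deg F P = 0" by simp
  then have "P i = \<zero>" for i
    using coeff_above_deg[OF P, of i] z by (cases "i = 0") auto
  then show False using nz by blast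
qed

lemma zero_up [simp]: "(\<lambda>i. \<zero>) \<in> up F"
  by (rule upI[of _ 0]) simp_all

lemma one_up [simp]: "(\<lambda>i. if i = 0 then \<one> else \<zero>) \<in> up F"
  by (rule up_one_closed)

lemma D_up [simp]:
  assumes "P \<in> up F"
  shows "D P \<in> up F"
  by (rule upI[of _ "Suc (deg F P)"])
    (auto simp: D_times_def deriv_closed assms coeff_above_deg[OF assms])

lemma iter_D_up [simp]: "P \<in> up F \<Longrightarrow> (D ^^ i) P \<in> up F"
  by (induct i) simp_all

subsection \<open>The action of an operator\<close>

text \<open>
  Sums of operators can have a smaller degree than the summands, so it is convenient to evaluate
  operators with any bound on the degree instead of the exact degree.
\<close>

lemma apply_op_eq:
  assumes P: "P \<in> up F" and N: "deg F P \<le> N" and a: "a \<in> carrier F"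
  shows "apply_op F \<delta> P a = (\<Oplus>i \<in> {..N}. P i \<otimes> (\<delta> ^^ i) a)"
  unfolding apply_op_def
  by (rule add.finprod_mono_neutral_cong_left)
    (use N in \<open>auto simp: P a coeff_above_deg[OF P]\<close>)

lemma apply_op_closed [simp]: "\<lbrakk> P \<in> up F; a \<in> carrier F \<rbrakk> \<Longrightarrow> apply_op F \<delta> P a \<in> carrier F"
  unfolding apply_op_def by (intro finsum_closed) auto

lemma apply_op_zero [simp]: "a \<in> carrier F \<Longrightarrow> apply_op F \<delta> (\<lambda>i. \<zero>) a = \<zero>"
  by (simp add: apply_op_def)

lemma apply_op_one [simp]:
  assumes "a \<in> carrier F"
  shows "apply_op F \<delta> (\<lambda>i. if i = 0 then \<one> else \<zero>) a = a"
proof -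
  have "deg F (\<lambda>i. if i = 0 then \<one> else \<zero>) \<le> 0" by (rule deg_leI) simp_all
  then show ?thesis using assms by (simp add: apply_op_eq[of _ 0])
qed

lemma apply_op_add:
  assumes P: "P \<in> up F" and Q: "Q \<in> up F" and a: "a \<in> carrier F"
  shows "apply_op F \<delta> (\<lambda>i. P i \<oplus> Q i) a = apply_op F \<delta> P a \<oplus> apply_op F \<delta> Q a"
proof -
  let ?N = "max (deg F P) (deg F Q)"
  have up: "(\<lambda>i. P i \<oplus> Q i) \<in> up F" using P Q by (rule up_add_closed)
  have "deg F (\<lambda>i. P i \<oplus> Q i) \<le> ?N"
    by (rule deg_leI[OF up]) (simp add: coeff_above_deg P Q)
  then show ?thesis
    using P Q up a
    by (simp add: apply_op_eq[of _ ?N] l_distr finsum_addf Pi_def cong: finsum_cong)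
qed

lemma apply_op_smult:
  assumes c: "c \<in> carrier F" and P: "P \<in> up F" and a: "a \<in> carrier F"
  shows "apply_op F \<delta> (\<lambda>i. c \<otimes> P i) a = c \<otimes> apply_op F \<delta> P a"
proof -
  have up: "(\<lambda>i. c \<otimes> P i) \<in> up F" using c P by (rule up_smult_closed)
  have "deg F (\<lambda>i. c \<otimes> P i) \<le> deg F P"
    by (rule deg_leI[OF up]) (simp add: coeff_above_deg P c)
  then show ?thesis
    using P up a c
    by (simp add: apply_op_eq[of _ "deg F P"] finsum_rdistr m_assoc Pi_def cong: finsum_cong)
qed

text \<open>
  \<open>D P\<close> is the composition \<open>\<partial> P\<close>. By the product rule each term \<open>P\<^sub>i a\<^sup>(\<^sup>i\<^sup>)\<close> has the derivative
  \<open>\<delta>(P\<^sub>i) a\<^sup>(\<^sup>i\<^sup>) + P\<^sub>i a\<^sup>(\<^sup>i\<^sup>+\<^sup>1\<^sup>)\<close>, and the second parts are the shifted coefficients of \<open>D P\<close>.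
  Truncating the sum at \<open>N\<close> leaves one shifted term over, which vanishes once \<open>N\<close> exceeds the
  degree.
\<close>

lemma apply_op_D:
  assumes P: "P \<in> up F" and a: "a \<in> carrier F"
  shows "apply_op F \<delta> (D P) a = \<delta> (apply_op F \<delta> P a)"
proof -
  have partial: "(\<Oplus>i \<in> {..N}. D P i \<otimes> (\<delta> ^^ i) a) \<oplus> P N \<otimes> (\<delta> ^^ Suc N) a =
      \<delta> (\<Oplus>i \<in> {..N}. P i \<otimes> (\<delta> ^^ i) a)" for N
  proof (induct N)
    case 0
    then show ?case using P a by (simp add: D_times_def deriv_mult deriv_closed)
  next
    case (Suc N)
    define S where "S = (\<Oplus>i \<in> {..N}. D P i \<otimes> (\<delta> ^^ i) a)"
    define T where "T = (\<Oplus>i \<in> {..N}. P i \<otimes> (\<delta> ^^ i) a)"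
    define b where "b = (\<delta> ^^ Suc N) a"
    have c: "S \<in> carrier F" "T \<in> carrier F" "b \<in> carrier F" "\<delta> b \<in> carrier F"
      unfolding S_def T_def b_def using P a
      by (auto intro!: finsum_closed deriv_closed iter_deriv_closed simp del: funpow.simps)
    have p: "P N \<in> carrier F" "P (Suc N) \<in> carrier F" "\<delta> (P (Suc N)) \<in> carrier F"
      using P deriv_closed by simp_all
    have IH: "S \<oplus> P N \<otimes> b = \<delta> T" using Suc by (simp add: S_def T_def b_def)
    have "(\<Oplus>i \<in> {..Suc N}. D P i \<otimes> (\<delta> ^^ i) a) = D P (Suc N) \<otimes> b \<oplus> S"
      unfolding S_def b_def using P a by (subst finsum_Suc) (auto simp del: funpow.simps)
    also have "\<dots> = \<delta> (P (Suc N)) \<otimes> b \<oplus> (S \<oplus> P N \<otimes> b)"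
      using c p by (simp add: D_times_def l_distr a_ac)
    finally have l: "(\<Oplus>i \<in> {..Suc N}. D P i \<otimes> (\<delta> ^^ i) a) = \<delta> (P (Suc N)) \<otimes> b \<oplus> \<delta> T"
      by (simp only: IH)
    have "(\<Oplus>i \<in> {..Suc N}. P i \<otimes> (\<delta> ^^ i) a) = P (Suc N) \<otimes> b \<oplus> T"
      unfolding T_def b_def using P a by (subst finsum_Suc) (auto simp del: funpow.simps)
    then have r: "\<delta> (\<Oplus>i \<in> {..Suc N}. P i \<otimes> (\<delta> ^^ i) a) =
        \<delta> (P (Suc N)) \<otimes> b \<oplus> P (Suc N) \<otimes> \<delta> b \<oplus> \<delta> T"
      using c p by (simp add: deriv_add deriv_mult)
    have "(\<delta> ^^ Suc (Suc N)) a = \<delta> b" by (simp add: b_def)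
    then show ?case
      unfolding l r using c p deriv_closed[OF c(2)] by (simp add: a_ac)
  qed
  let ?N = "Suc (deg F P)"
  have N: "P ?N = \<zero>" using coeff_above_deg[OF P] by simp
  have "deg F (D P) \<le> ?N"
    by (rule deg_leI[OF D_up[OF P]]) (simp add: D_times_def coeff_above_deg[OF P])
  then have "apply_op F \<delta> (D P) a = (\<Oplus>i \<in> {..?N}. D P i \<otimes> (\<delta> ^^ i) a)"
    using P a by (intro apply_op_eq) simp_all
  also have "\<dots> = (\<Oplus>i \<in> {..?N}. D P i \<otimes> (\<delta> ^^ i) a) \<oplus> P ?N \<otimes> (\<delta> ^^ Suc ?N) a"
  proof -
    have "(\<Oplus>i \<in> {..?N}. D P i \<otimes> (\<delta> ^^ i) a) \<in> carrier F"
      using P a by (intro finsum_closed) (simp add: Pi_def)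
    moreover have "P ?N \<otimes> (\<delta> ^^ Suc ?N) a = \<zero>"
      using a iter_deriv_closed[of a "Suc ?N"] by (simp only: N l_null)
    ultimately show ?thesis by (simp only: r_zero)
  qed
  also have "\<dots> = \<delta> (apply_op F \<delta> P a)"
    unfolding partial using P a by (simp add: apply_op_eq[of P ?N])
  finally show ?thesis .
qed

lemma apply_op_iter_D:
  "\<lbrakk> P \<in> up F; a \<in> carrier F \<rbrakk> \<Longrightarrow> apply_op F \<delta> ((D ^^ i) P) a = (\<delta> ^^ i) (apply_op F \<delta> P a)"
  by (induct i) (simp_all add: apply_op_D)

text \<open>
  The product of operators is such a combination, with \<open>P i\<close> the operators \<open>\<partial>\<^sup>i Q\<close>.
\<close>

lemma apply_op_combination:
  fixes m :: nat
  assumes c: "\<And>i. c i \<in> carrier F" and P: "\<And>i. P i \<in> up F"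
  shows "(\<lambda>n. \<Oplus>i \<in> {..m}. c i \<otimes> P i n) \<in> up F \<and> (\<forall>a \<in> carrier F.
    apply_op F \<delta> (\<lambda>n. \<Oplus>i \<in> {..m}. c i \<otimes> P i n) a = (\<Oplus>i \<in> {..m}. c i \<otimes> apply_op F \<delta> (P i) a))"
proof (induct m)
  case 0
  then show ?case using c P by (simp add: up_smult_closed apply_op_smult)
next
  case (Suc m)
  have "(\<lambda>n. \<Oplus>i \<in> {..Suc m}. c i \<otimes> P i n) =
      (\<lambda>n. c (Suc m) \<otimes> P (Suc m) n \<oplus> (\<Oplus>i \<in> {..m}. c i \<otimes> P i n))"
    using c P by (intro ext, subst finsum_Suc) auto
  moreover have "(\<lambda>n. c (Suc m) \<otimes> P (Suc m) n) \<in> up F"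
    using c P by (intro up_smult_closed)
  ultimately show ?case
    using Suc c P by (simp add: up_add_closed apply_op_add apply_op_smult)
qed

lemma mult_up [simp]: "\<lbrakk> P \<in> up F; Q \<in> up F \<rbrakk> \<Longrightarrow> P \<otimes>\<^bsub>ops\<^esub> Q \<in> up F"
  using apply_op_combination[of P "\<lambda>i. (D ^^ i) Q" "deg F P"] by (simp add: ops_simps)

lemma apply_op_mult:
  assumes P: "P \<in> up F" and Q: "Q \<in> up F" and a: "a \<in> carrier F"
  shows "apply_op F \<delta> (P \<otimes>\<^bsub>ops\<^esub> Q) a = apply_op F \<delta> P (apply_op F \<delta> Q a)"
  using apply_op_combination[of P "\<lambda>i. (D ^^ i) Q" "deg F P"] assms
  by (simp add: ops_simps apply_op_iter_D apply_op_def[of F \<delta> P])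

lemma apply_op_linear:
  assumes P: "P \<in> up F"
  shows "restrict (apply_op F \<delta> P) (carrier F) \<in> carrier lin.E"
proof (rule lin.lin_endI)
  fix a b assume a: "a \<in> carrier F" and b: "b \<in> carrier F"
  then show "apply_op F \<delta> P (a \<oplus> b) = apply_op F \<delta> P a \<oplus> apply_op F \<delta> P b"
    using P by (simp add: apply_op_def iter_deriv_add r_distr finsum_addf Pi_def
        cong: finsum_cong)
next
  fix k a assume k: "k \<in> const_field" and a: "a \<in> carrier F"
  then have "k \<in> carrier F" by (simp add: constants_def)
  then show "apply_op F \<delta> P (k \<otimes> a) = k \<otimes> apply_op F \<delta> P a"
    using P k a by (simp add: apply_op_def iter_deriv_const finsum_rdistr m_lcomm Pi_def
        cong: finsum_cong)
qed (simp add: P)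

definition action :: "(nat \<Rightarrow> 'a) \<Rightarrow> 'a \<Rightarrow> 'a"
  where "action P = restrict (apply_op F \<delta> P) (carrier F)"

lemma action_apply [simp]: "a \<in> carrier F \<Longrightarrow> action P a = apply_op F \<delta> P a"
  by (simp add: action_def)

lemma action_closed [simp]: "P \<in> up F \<Longrightarrow> action P \<in> carrier lin.E"
  unfolding action_def by (rule apply_op_linear)

lemma action_hom: "action \<in> ring_hom ops lin.E"
  by (intro ring_hom_memI lin.lin_end_eqI)
    (simp_all add: ops_simps(1-4) lin.lin_end_closed apply_op_mult apply_op_add up_add_closed)

end


section \<open>The Ore domain of differential operators\<close>

locale solvable_differential_field = differential_field +
  assumes onto: "\<lbrakk> P \<in> carrier (diff_ops F \<delta>); P \<noteq> \<zero>\<^bsub>diff_ops F \<delta>\<^esub> \<rbrakk> \<Longrightarrow>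
      apply_op F \<delta> P ` carrier F = carrier F"
begin

text \<open>
  A nonzero operator maps onto \<open>F\<close>, so it hits \<open>1\<close>.
\<close>

lemma action_eq_zeroD:
  assumes P: "P \<in> up F" and z: "\<And>a. a \<in> carrier F \<Longrightarrow> apply_op F \<delta> P a = \<zero>"
  shows "P = (\<lambda>i. \<zero>)"
proof (rule ccontr)
  assume "P \<noteq> (\<lambda>i. \<zero>)"
  then have "apply_op F \<delta> P ` carrier F = carrier F" using P onto by (simp add: ops_simps)
  then have "\<one> \<in> apply_op F \<delta> P ` carrier F" by simp
  then show False using z by (auto simp: image_iff)
qed

lemma apply_op_neg:
  assumes P: "P \<in> up F" and a: "a \<in> carrier F"
  shows "apply_op F \<delta> (\<lambda>i. \<ominus> P i) a = \<ominus> apply_op F \<delta> P a"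
proof (rule minus_equality[symmetric])
  have "apply_op F \<delta> (\<lambda>i. \<ominus> P i \<oplus> P i) a = \<zero>" using P a by (simp add: l_neg)
  then show "apply_op F \<delta> (\<lambda>i. \<ominus> P i) a \<oplus> apply_op F \<delta> P a = \<zero>"
    using P a by (simp add: apply_op_add up_a_inv_closed)
qed (simp_all add: P a up_a_inv_closed)

lemma action_inj: "inj_on action (up F)"
proof (rule inj_onI)
  fix P Q assume P: "P \<in> up F" and Q: "Q \<in> up F" and eq: "action P = action Q"
  have "apply_op F \<delta> (\<lambda>i. P i \<oplus> \<ominus> Q i) a = \<zero>" if a: "a \<in> carrier F" for a
    using fun_cong[OF eq, of a] P Q a by (simp add: apply_op_add up_a_inv_closed apply_op_neg r_neg)
  then have zero: "(\<lambda>i. P i \<oplus> \<ominus> Q i) = (\<lambda>i. \<zero>)"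
    using P Q by (intro action_eq_zeroD up_add_closed up_a_inv_closed)
  show "P = Q"
  proof
    fix i
    have "P i \<ominus> Q i = \<zero>" using fun_cong[OF zero, of i] by (simp add: a_minus_def)
    then show "P i = Q i" using P Q by simp
  qed
qed

text \<open>
  Associativity and distributivity hold because they hold for the composition and the pointwise sum
  of linear maps.
\<close>

lemma ops_ring: "ring ops"
proof (rule ring_if_embeds[OF lin.lin_end_ring _ action_hom])
  show "inj_on action (carrier ops)" using action_inj by (simp add: ops_simps)
  show "action \<zero>\<^bsub>ops\<^esub> = \<zero>\<^bsub>lin.E\<^esub>"
    by (rule lin.lin_end_eqI) (simp_all add: ops_simps lin.lin_end_closed)
  fix P assume "P \<in> carrier ops"
  then have P: "P \<in> up F" by (simp add: ops_simps)
  interpret E: ring lin.E by (rule lin.lin_end_ring)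
  have "action (\<lambda>i. \<ominus> P i) = \<ominus>\<^bsub>lin.E\<^esub> action P"
    by (rule lin.lin_end_eqI) (simp_all add: P up_a_inv_closed lin.lin_end_a_inv apply_op_neg)
  then show "\<exists>Q \<in> carrier ops. action Q = \<ominus>\<^bsub>lin.E\<^esub> action P"
    using up_a_inv_closed[OF P] by (auto simp: ops_simps)
qed (simp_all add: ops_simps(1-4) up_add_closed)

sublocale ops: ring ops by (rule ops_ring)

lemma ops_mult_nonzero:
  assumes P: "P \<in> up F" and Q: "Q \<in> up F" and nz: "P \<noteq> \<zero>\<^bsub>ops\<^esub>" "Q \<noteq> \<zero>\<^bsub>ops\<^esub>"
  shows "P \<otimes>\<^bsub>ops\<^esub> Q \<noteq> \<zero>\<^bsub>ops\<^esub>"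
proof
  assume z: "P \<otimes>\<^bsub>ops\<^esub> Q = \<zero>\<^bsub>ops\<^esub>"
  have "apply_op F \<delta> P b = \<zero>" if b: "b \<in> carrier F" for b
  proof -
    obtain a where a: "a \<in> carrier F" "b = apply_op F \<delta> Q a"
      using onto[of Q] Q nz(2) b by (force simp: ops_simps(1))
    then show ?thesis using apply_op_mult[OF P Q a(1)] z by (simp add: ops_simps(2))
  qed
  then show False using action_eq_zeroD[OF P] nz(1) by (simp add: ops_simps(2))
qed

subsection \<open>Division with remainder on the right\<close>

definition op_monom :: "'a \<Rightarrow> nat \<Rightarrow> nat \<Rightarrow> 'a"
  where "op_monom c k = (\<lambda>i. if i = k then c else \<zero>)"

lemma op_monom_up [simp]: "c \<in> carrier F \<Longrightarrow> op_monom c k \<in> up F"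
  by (rule upI[of _ k]) (simp_all add: op_monom_def)

lemma op_monom_deg:
  assumes "c \<in> carrier F" "c \<noteq> \<zero>"
  shows "deg F (op_monom c k) = k"
proof -
  have up: "op_monom c k \<in> up F" using assms(1) by simp
  have "deg F (op_monom c k) \<le> k" by (rule deg_leI[OF up]) (simp add: op_monom_def)
  moreover have "op_monom c k k \<noteq> \<zero>" using assms(2) by (simp add: op_monom_def)
  then have "k \<le> deg F (op_monom c k)" using coeff_above_deg[OF up, of k] not_le by blast
  ultimately show ?thesis by simp
qed

lemma op_monom_mult:
  assumes c: "c \<in> carrier F" "c \<noteq> \<zero>" and Q: "Q \<in> up F"
  shows "(op_monom c k \<otimes>\<^bsub>ops\<^esub> Q) n = c \<otimes> (D ^^ k) Q n"
proof -
  have "(op_monom c k \<otimes>\<^bsub>ops\<^esub> Q) n = (\<Oplus>i \<in> {..k}. op_monom c k i \<otimes> (D ^^ i) Q n)"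
    using c Q by (simp add: ops_simps op_monom_deg)
  also have "\<dots> = (\<Oplus>i \<in> {..k}. if k = i then c \<otimes> (D ^^ i) Q n else \<zero>)"
    using c Q by (intro finsum_cong') (auto simp: op_monom_def)
  also have "\<dots> = c \<otimes> (D ^^ k) Q n"
    using c Q by (intro add.finprod_singleton) auto
  finally show ?thesis .
qed

text \<open>
  Moving \<open>\<partial>\<close> past a coefficient only adds terms of lower order, so the leading term of
  \<open>\<partial>\<^sup>k Q\<close> is that of \<open>Q\<close> shifted by \<open>k\<close>.
\<close>

lemma iter_D_leading:
  assumes Q: "Q \<in> up F"
  shows "(D ^^ k) Q (deg F Q + k) = Q (deg F Q)" "deg F Q + k < i \<Longrightarrow> (D ^^ k) Q i = \<zero>"
proof (induct k arbitrary: i)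
  case 0
  { case 1 show ?case by simp }
  { case 2 then show ?case using coeff_above_deg[OF Q] by simp }
next
  case (Suc k)
  { case 1 show ?case using Suc Q by (simp add: D_times_def) }
  { case 2 then show ?case using Suc(2)[of i] Suc(2)[of "i - 1"] by (simp add: D_times_def) }
qed

text \<open>
  As for polynomials, the leading term of \<open>P\<close> is cancelled by subtracting \<open>c \<partial>\<^sup>k Q\<close>, where \<open>c\<close> is the
  quotient of the leading coefficients. The remainder is described by its vanishing coefficients
  and not by its degree, because the zero operator shares the degree 0 with the nonzero constants.
\<close>

lemma right_division:
  assumes Q: "Q \<in> up F" "Q \<noteq> \<zero>\<^bsub>ops\<^esub>" and "P \<in> up F" "\<And>i. N \<le> i \<Longrightarrow> P i = \<zero>"
  shows "\<exists>A \<in> up F. \<exists>B \<in> up F. P = A \<otimes>\<^bsub>ops\<^esub> Q \<oplus>\<^bsub>ops\<^esub> B \<and> (\<forall>i \<ge> deg F Q. B i = \<zero>)"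
  using assms(3,4)
proof (induct N arbitrary: P)
  case 0
  then have "P = \<zero>\<^bsub>ops\<^esub>" by (auto simp: ops_simps)
  then show ?case
    using Q ops.l_null[of Q] ops.r_zero[of "\<zero>\<^bsub>ops\<^esub>"]
    by (intro bexI[of _ "\<zero>\<^bsub>ops\<^esub>"]) (simp_all add: ops_simps(1,2))
next
  case (Suc N)
  note P = Suc.prems(1)
  consider "N < deg F Q" | "P N = \<zero>" | "deg F Q \<le> N" "P N \<noteq> \<zero>" by linarith
  then show ?case
  proof cases
    case 1
    then show ?thesis
      using Q(1) P Suc.prems(2) ops.l_null[of Q] ops.l_zero[of P]
      by (intro bexI[of _ "\<zero>\<^bsub>ops\<^esub>"] bexI[of _ P]) (simp_all add: ops_simps(1,2))
  next
    case 2
    then have "P i = \<zero>" if "N \<le> i" for i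
      using Suc.prems(2)[of i] that by (cases "i = N") auto
    then show ?thesis using Suc.hyps[OF P] by blast
  next
    case 3
    let ?q = "Q (deg F Q)"
    define c where "c = P N \<otimes> inv ?q"
    define L where "L = op_monom c (N - deg F Q) \<otimes>\<^bsub>ops\<^esub> Q"
    have q: "?q \<in> Units F" using lead_coeff_nonzero[of Q] Q by (simp add: field_Units ops_simps)
    have c: "c \<in> carrier F" "c \<noteq> \<zero>" "c \<otimes> ?q = P N"
    proof -
      show 1: "c \<in> carrier F" using P q by (simp add: c_def)
      show 2: "c \<otimes> ?q = P N" using P q Q by (simp add: c_def m_assoc)
      show "c \<noteq> \<zero>" using 2 3 Q by auto
    qed
    have M: "op_monom c (N - deg F Q) \<in> up F" using c by simp
    have L: "L \<in> up F" using c Q by (simp add: L_def)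
    have LN: "L N = P N" "\<And>i. N < i \<Longrightarrow> L i = \<zero>"
      using iter_D_leading[OF Q(1), of "N - deg F Q"] 3(1) c Q(1)
      by (simp_all add: L_def op_monom_mult)
    define P' where "P' = (\<lambda>i. P i \<oplus> \<ominus> L i)"
    have P': "P' \<in> up F" unfolding P'_def using P L by (intro up_add_closed up_a_inv_closed)
    have "P' i = \<zero>" if "N \<le> i" for i
      using LN(2)[of i] LN(1) Suc.prems(2)[of i] that P by (cases "i = N") (simp_all add: P'_def r_neg)
    then obtain A B where AB: "A \<in> up F" "B \<in> up F" "P' = A \<otimes>\<^bsub>ops\<^esub> Q \<oplus>\<^bsub>ops\<^esub> B"
      "\<forall>i \<ge> deg F Q. B i = \<zero>" using Suc.hyps[OF P'] by blast
    have "P = L \<oplus>\<^bsub>ops\<^esub> P'"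
    proof
      fix i
      have "L i \<oplus> (P i \<oplus> \<ominus> L i) = P i"
        using P L by (subst a_lcomm) (simp_all add: r_neg)
      then show "P i = (L \<oplus>\<^bsub>ops\<^esub> P') i"
        unfolding ops_simps(4)[OF L P'] by (simp add: P'_def)
    qed
    also have "\<dots> = (op_monom c (N - deg F Q) \<oplus>\<^bsub>ops\<^esub> A) \<otimes>\<^bsub>ops\<^esub> Q \<oplus>\<^bsub>ops\<^esub> B"
      using M Q(1) AB(1,2) unfolding AB(3) L_def
      by (simp add: ops_simps(1)[symmetric] ops.l_distr ops.a_assoc)
    finally show ?thesis
      using AB M ops.a_closed[of "op_monom c (N - deg F Q)" A] by (auto simp: ops_simps(1))
  qed
qed

text \<open>
  Euclid's algorithm: if \<open>P = A Q + B\<close> with \<open>B\<close> of smaller degree than \<open>Q\<close>, and \<open>V Q = U B\<close> with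
  \<open>V \<noteq> 0\<close> by induction, then \<open>U P = (U A + V) Q\<close>. Here \<open>U \<noteq> 0\<close>, since \<open>U B = V Q \<noteq> 0\<close>.
\<close>

lemma ops_left_ore:
  assumes "P \<in> carrier ops" "Q \<in> carrier ops" "Q \<noteq> \<zero>\<^bsub>ops\<^esub>"
  shows "\<exists>U \<in> carrier ops. \<exists>V \<in> carrier ops. V \<noteq> \<zero>\<^bsub>ops\<^esub> \<and> V \<otimes>\<^bsub>ops\<^esub> P = U \<otimes>\<^bsub>ops\<^esub> Q"
  using assms
proof (induct "deg F Q" arbitrary: P Q rule: less_induct)
  case less
  note P = less.prems(1) and Q = less.prems(2,3)
  have up: "P \<in> up F" "Q \<in> up F" using P Q by (simp_all add: ops_simps)
  obtain A B where AB: "A \<in> carrier ops" "B \<in> carrier ops" "P = A \<otimes>\<^bsub>ops\<^esub> Q \<oplus>\<^bsub>ops\<^esub> B"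
    and small: "\<forall>i \<ge> deg F Q. B i = \<zero>"
    using right_division[OF up(2) Q(2) up(1), of "Suc (deg F P)"] coeff_above_deg[OF up(1)]
    by (auto simp: ops_simps(1))
  show ?case
  proof (cases "B = \<zero>\<^bsub>ops\<^esub>")
    case True
    then have "\<one>\<^bsub>ops\<^esub> \<otimes>\<^bsub>ops\<^esub> P = A \<otimes>\<^bsub>ops\<^esub> Q" using AB P Q by simp
    moreover have "\<one>\<^bsub>ops\<^esub> \<noteq> \<zero>\<^bsub>ops\<^esub>" by (auto simp: ops_simps fun_eq_iff intro: exI[of _ 0])
    ultimately show ?thesis using AB(1) by blast
  next
    case False
    have "B (deg F B) \<noteq> \<zero>" using lead_coeff_nonzero[of B] AB(2) False by (simp add: ops_simps)
    then have "deg F B < deg F Q" using small not_le by blast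
    then obtain U V where UV: "U \<in> carrier ops" "V \<in> carrier ops" "V \<noteq> \<zero>\<^bsub>ops\<^esub>"
      "V \<otimes>\<^bsub>ops\<^esub> Q = U \<otimes>\<^bsub>ops\<^esub> B" using less.hyps[OF _ Q(1) AB(2) False] by blast
    have "V \<otimes>\<^bsub>ops\<^esub> Q \<noteq> \<zero>\<^bsub>ops\<^esub>" using UV Q by (intro ops_mult_nonzero) (simp_all add: ops_simps(1))
    then have "U \<noteq> \<zero>\<^bsub>ops\<^esub>" using UV AB(2) by auto
    moreover have "U \<otimes>\<^bsub>ops\<^esub> P = (U \<otimes>\<^bsub>ops\<^esub> A \<oplus>\<^bsub>ops\<^esub> V) \<otimes>\<^bsub>ops\<^esub> Q"
      using UV(1,2) AB(1,2) Q(1) by (simp add: AB(3) ops.l_distr ops.r_distr UV(4) ops.m_assoc)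
    moreover have "U \<otimes>\<^bsub>ops\<^esub> A \<oplus>\<^bsub>ops\<^esub> V \<in> carrier ops" using UV AB by simp
    ultimately show ?thesis using UV(1) by blast
  qed
qed

subsection \<open>Extension to fractions\<close>

text \<open>
  The localisation theorem for the composition of \<open>action\<close> with the quotient map. The homomorphism
  it extends is injective because its target is not the zero ring.
\<close>

theorem fractions_embed_in_Calkin:
  assumes kernel_dim: "\<And>P. \<lbrakk> P \<in> carrier ops; P \<noteq> \<zero>\<^bsub>ops\<^esub> \<rbrakk> \<Longrightarrow>
      dimension (deg F P) const_field {a \<in> carrier F. apply_op F \<delta> P a = \<zero>}"
  shows "\<exists>\<phi>. ring_hom_ring (skew_fraction_field ops) Calkin \<phi> \<and>
    inj_on \<phi> (carrier (skew_fraction_field ops)) \<and>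
    (\<forall>P \<in> carrier ops. \<phi> (frac_embed ops P) = calkin_class F \<delta> P)"
proof -
  have class_eq: "calkin_class F \<delta> P = lin.I +>\<^bsub>lin.E\<^esub> action P" for P
    by (simp add: calkin_class_def action_def)
  have "infinite_dimension const_field (carrier F)"
  proof
    assume "finite_dimension const_field (carrier F)"
    then obtain n where n: "dimension n const_field (carrier F)" by auto
    \<comment> \<open>The kernel of \<open>\<partial>\<^sup>n\<^sup>+\<^sup>1\<close> is a subspace of dimension \<open>n + 1\<close>.\<close>
    let ?P = "op_monom \<one> (Suc n)"
    have "?P \<noteq> \<zero>\<^bsub>ops\<^esub>" by (auto simp: ops_simps op_monom_def fun_eq_iff intro: exI[of _ "Suc n"])
    then have "dimension (Suc n) const_field {a \<in> carrier F. apply_op F \<delta> ?P a = \<zero>}"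
      using kernel_dim[of ?P] op_monom_deg[of \<one> "Suc n"] by (simp add: ops_simps(1))
    then obtain Us where Us: "set Us \<subseteq> carrier F" "independent const_field Us" "length Us = Suc n"
      using exists_base[OF const_subfield] by blast
    then show False
      using independent_length_le_dimension[OF const_subfield n Us(2,1)] by simp
  qed
  note nontrivial = lin.calkin_nontrivial[OF this]
  have unit: "calkin_class F \<delta> P \<in> Units Calkin" if P: "P \<in> carrier ops" "P \<noteq> \<zero>\<^bsub>ops\<^esub>" for P
  proof -
    have "action P ` carrier F = carrier F" using onto[OF P] by (simp add: action_def)
    moreover have "finite_dimension const_field {a \<in> carrier F. action P a = \<zero>}"
      using finite_dimensionI[OF kernel_dim[OF P]] by (simp cong: conj_cong)
    ultimately show ?thesis
      using P(1) unfolding class_eq by (intro lin.calkin_unit) (simp_all add: ops_simps(1))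
  qed
  interpret q: ring_hom_ring lin.E Calkin "(+>\<^bsub>lin.E\<^esub>) lin.I" by (rule lin.calkin_hom)
  have "calkin_class F \<delta> \<in> ring_hom ops Calkin"
    using ring_hom_trans[OF action_hom q.homh] by (simp add: class_eq[abs_def] comp_def)
  then interpret h: ring_hom_ring ops Calkin "calkin_class F \<delta>"
    by (intro ring_hom_ringI2 ops_ring q.S.ring_axioms)
  interpret ore_ring_hom ops Calkin "calkin_class F \<delta>"
    by unfold_locales (use unit nontrivial ops_left_ore in blast)+
  show ?thesis
    using skew_fraction_field_embeds class_val_inj class_val_frac_embed by blast
qed

end

theorem proposition5p3:
  fixes F :: "('a, 'm) ring_scheme" and \<delta> :: "'a \<Rightarrow> 'a"
  defines "C \<equiv> constants F \<delta>"
  assumes diff_field: "differential_field F \<delta>"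
    and char_zero: "\<And>n::nat. n > 0 \<Longrightarrow> [n] \<cdot>\<^bsub>F\<^esub> \<one>\<^bsub>F\<^esub> \<noteq> \<zero>\<^bsub>F\<^esub>"
    and lin_closed: "linearly_differentially_closed F \<delta>"
    and factorization: "\<And>P. P \<in> carrier (diff_ops F \<delta>) \<Longrightarrow>
      \<exists>Ls. set Ls \<subseteq> {L \<in> carrier (diff_ops F \<delta>). deg F L \<le> 1} \<and>
        P = foldr (\<lambda>L Q. L \<otimes>\<^bsub>diff_ops F \<delta>\<^esub> Q) Ls \<one>\<^bsub>diff_ops F \<delta>\<^esub>"
    and onto: "\<And>P. P \<in> carrier (diff_ops F \<delta>) \<Longrightarrow> P \<noteq> \<zero>\<^bsub>diff_ops F \<delta>\<^esub> \<Longrightarrow>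
      apply_op F \<delta> P ` carrier F = carrier F"
    and kernel_dim: "\<And>P. P \<in> carrier (diff_ops F \<delta>) \<Longrightarrow> P \<noteq> \<zero>\<^bsub>diff_ops F \<delta>\<^esub> \<Longrightarrow>
      ring.dimension F (deg F P) C {a \<in> carrier F. apply_op F \<delta> P a = \<zero>\<^bsub>F\<^esub>}"
    and alg_closed: "algebraically_closed (F\<lparr> carrier := C \<rparr>)"
    and proper: "C \<noteq> carrier F"
  shows "\<exists>\<phi>. ring_hom_ring (skew_fraction_field (diff_ops F \<delta>)) (calkin_algebra F C (carrier F)) \<phi> \<and>
    inj_on \<phi> (carrier (skew_fraction_field (diff_ops F \<delta>))) \<and>
    (\<forall>P \<in> carrier (diff_ops F \<delta>). \<phi> (frac_embed (diff_ops F \<delta>) P) = calkin_class F \<delta> P)"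
proof -
  interpret differential_field F \<delta> by (rule diff_field)
  interpret solvable_differential_field F \<delta> by unfold_locales (rule onto)
  show ?thesis
    using fractions_embed_in_Calkin kernel_dim unfolding C_def by blast
qed

end
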